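(* Let $U\subset\mathbb{R}^n$ be a smooth bounded domain, $0<s<1$, and let $d$ be a distance on $\mathbb{R}^n$ equivalent to the Euclidean one. Let $\Lambda^N_{s,\infty}=\lim_{p\to+\infty}(\lambda^N_{s,p})^{1/p}$, where $\lambda^N_{s,p}$ is the first nontrivial Neumann eigenvalue defined (using $d$) in the context. Then $$\frac{2}{\Lambda^N_{s,\infty}}=\max\Big\{W_s(\sigma^+,\sigma^-) : \sigma\in M(\overline U),\ \sigma^+(\overline U)=\sigma^-(\overline U)=1\Big\},$$ where $$W_s(\mu,\nu)=\inf_\pi\int_{\overline U}\int_{\overline U}|x-y|^s\,d\pi(x,y),$$ the infimum being over all probability measures $\pi\in P(\overline U\times\overline U)$ with marginals $\mu$ and $\nu$.
   Context: $|x-y|$ is the Euclidean distance, and $P(A)$ is the set of probability measures on $A$. $M(\overline U)$ is the space of finite (signed) Borel measures on $\overline U$; for $\sigma\in M(\overline U)$, $\sigma^+$ and $\sigma^-$ denote its positive and negative parts, so that $\sigma=\sigma^+-\sigma^-$ and $|\sigma|=\sigma^++\sigma^-$. For $1<p<+\infty$, $$\lambda^N_{s,p}=\inf\{\llbracket u\rrbracket_{s,p}^p : u\in\mathcal C\},\qquad \llbracket u\rrbracket_{s,p}^p=\int_U\int_U\frac{|u(x)-u(y)|^p}{d(x,y)^{n+sp}}\,dx\,dy,$$ $$\mathcal C=\Big\{u\in W^{s,p}(U): \|u\|_{L^p(U)}=1,\ \int_U|u|^{p-2}u\,dx=0\Big\},$$ where $W^{s,p}(U)$ is the usual fractional Sobolev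 space. The limit $\Lambda^N_{s,\infty}=\lim_{p\to+\infty}(\lambda^N_{s,p})^{1/p}$ exists and is positive and finite.
   Formalization: The cost |x-y|^s in W_s is replaced by d(x,y)^s with the same distance d as in Λ; as printed the claim fails, e.g. for d = 2|x-y|, where 2/Λ is multiplied by 2^s but the right side is unchanged. For d Euclidean it is the printed formula. *)

theory Defs
  imports "HOL-Analysis.Analysis"
begin

section \<open>Smooth bounded domains\<close>

text \<open>\<open>k_times_cont_diff k f\<close>: \<open>f\<close> is of class \<open>C\<^sup>k\<close> on the whole space, by recursion on the
  directional derivatives.\<close>

fun k_times_cont_diff :: "nat \<Rightarrow> ('a::euclidean_space \<Rightarrow> real) \<Rightarrow> bool" where
  "k_times_cont_diff 0 f \<longleftrightarrow> continuous_on UNIV f"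
| "k_times_cont_diff (Suc k) f \<longleftrightarrow>
     (\<forall>x. f differentiable (at x)) \<and>
     (\<forall>v. k_times_cont_diff k (\<lambda>x. frechet_derivative f (at x) v))"

definition smooth_fun :: "('a::euclidean_space \<Rightarrow> real) \<Rightarrow> bool" where
  "smooth_fun f \<longleftrightarrow> (\<forall>k. k_times_cont_diff k f)"

text \<open>Near each boundary point, \<open>U\<close> is the region above the graph of a smooth function in some
  system of orthonormal coordinates: \<open>e\<close> is the vertical direction, and the graph function is
  evaluated only on the hyperplane orthogonal to \<open>e\<close>, at the projection \<open>x - (x \<bullet> e) *\<^sub>R e\<close>.\<close>

definition smooth_boundary :: "'a::euclidean_space set \<Rightarrow> bool" where
  "smooth_boundary U \<longleftrightarrow>
     (\<forall>x0 \<in> frontier U. \<exists>r>0. \<exists>e g. norm e = 1 \<and> smooth_fun g \<and>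
        U \<inter> ball x0 r = {x \<in> ball x0 r. g (x - (x \<bullet> e) *\<^sub>R e) < x \<bullet> e})"

definition smooth_bounded_domain :: "'a::euclidean_space set \<Rightarrow> bool" where
  "smooth_bounded_domain U \<longleftrightarrow>
     open U \<and> connected U \<and> U \<noteq> {} \<and> bounded U \<and> smooth_boundary U"


section \<open>Distances equivalent to the Euclidean one\<close>

definition equivalent_distance :: "('a::euclidean_space \<Rightarrow> 'a \<Rightarrow> real) \<Rightarrow> bool" where
  "equivalent_distance d \<longleftrightarrow> Metric_space UNIV d \<and>
     (\<exists>c>0. \<exists>C>0. \<forall>x y. c * dist x y \<le> d x y \<and> d x y \<le> C * dist x y)"


section \<open>The fractional Neumann eigenvalue and its limit\<close>

text \<open>The \<open>p\<close>-th power of the Gagliardo seminorm built with the distance \<open>d\<close>. On the diagonal the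
  integrand is \<open>0 / 0 = 0\<close>.\<close>

definition gagliardo ::
  "('a::euclidean_space \<Rightarrow> 'a \<Rightarrow> real) \<Rightarrow> real \<Rightarrow> real \<Rightarrow> 'a set \<Rightarrow> ('a \<Rightarrow> real) \<Rightarrow> ennreal" where
  "gagliardo d s p U u =
     (\<integral>\<^sup>+x. (\<integral>\<^sup>+y. ennreal (\<bar>u x - u y\<bar> powr p / d x y powr (real DIM('a) + s * p))
        \<partial>lebesgue_on U) \<partial>lebesgue_on U)"

text \<open>The usual space \<open>W\<^sup>s\<^sup>,\<^sup>p(U)\<close>, with the Euclidean distance; its elements are functions rather
  than classes of functions equal almost everywhere.\<close>

definition frac_sobolev :: "real \<Rightarrow> real \<Rightarrow> 'a::euclidean_space set \<Rightarrow> ('a \<Rightarrow> real) set" where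
  "frac_sobolev s p U =
     {u. u \<in> borel_measurable (lebesgue_on U) \<and>
         (\<integral>\<^sup>+x. ennreal (\<bar>u x\<bar> powr p) \<partial>lebesgue_on U) < \<infinity> \<and>
         gagliardo dist s p U u < \<infinity>}"

definition Lp_norm :: "real \<Rightarrow> 'a::euclidean_space set \<Rightarrow> ('a \<Rightarrow> real) \<Rightarrow> real" where
  "Lp_norm p U u = (\<integral>x. \<bar>u x\<bar> powr p \<partial>lebesgue_on U) powr (1 / p)"

definition neumann_admissible :: "real \<Rightarrow> real \<Rightarrow> 'a::euclidean_space set \<Rightarrow> ('a \<Rightarrow> real) set" where
  "neumann_admissible s p U =
     {u \<in> frac_sobolev s p U. Lp_norm p U u = 1 \<and>
        (\<integral>x. \<bar>u x\<bar> powr (p - 2) * u x \<partial>lebesgue_on U) = 0}"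

definition neumann_eigenvalue ::
  "('a::euclidean_space \<Rightarrow> 'a \<Rightarrow> real) \<Rightarrow> real \<Rightarrow> real \<Rightarrow> 'a set \<Rightarrow> ennreal" where
  "neumann_eigenvalue d s p U = (INF u \<in> neumann_admissible s p U. gagliardo d s p U u)"

definition neumann_limit ::
  "('a::euclidean_space \<Rightarrow> 'a \<Rightarrow> real) \<Rightarrow> real \<Rightarrow> 'a set \<Rightarrow> real" where
  "neumann_limit d s U = Lim at_top (\<lambda>p. enn2real (neumann_eigenvalue d s p U) powr (1 / p))"


section \<open>Signed measures and optimal transport\<close>

abbreviation borel_on :: "'a::topological_space set \<Rightarrow> 'a measure" where
  "borel_on K \<equiv> restrict_space borel K"

text \<open>Finite signed Borel measures on \<open>K\<close>, as real-valued countably additive set functions. Only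
  the values on Borel subsets of \<open>K\<close> matter.\<close>

definition signed_borel_measures :: "'a::topological_space set \<Rightarrow> ('a set \<Rightarrow> real) set" where
  "signed_borel_measures K =
     {\<sigma>. \<forall>A :: nat \<Rightarrow> 'a set. range A \<subseteq> sets (borel_on K) \<longrightarrow> disjoint_family A \<longrightarrow>
           (\<lambda>i. \<sigma> (A i)) sums \<sigma> (\<Union>i. A i)}"

text \<open>The positive and negative parts are the upper and lower variations of the Jordan
  decomposition. Negative values of \<open>\<sigma> B\<close> are truncated to \<open>0\<close> by \<^const>\<open>ennreal\<close>; this does not
  change the supremum, as \<open>B = {}\<close> already contributes \<open>0\<close>.\<close>

definition pos_part :: "'a::topological_space set \<Rightarrow> ('a set \<Rightarrow> real) \<Rightarrow> 'a measure" where
  "pos_part K \<sigma> = measure_of K (sets (borel_on K))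
     (\<lambda>A. SUP B \<in> {B \<in> sets (borel_on K). B \<subseteq> A}. ennreal (\<sigma> B))"

definition neg_part :: "'a::topological_space set \<Rightarrow> ('a set \<Rightarrow> real) \<Rightarrow> 'a measure" where
  "neg_part K \<sigma> = pos_part K (\<lambda>A. - \<sigma> A)"

definition borel_probs :: "'a::topological_space set \<Rightarrow> 'a measure set" where
  "borel_probs K = {\<mu>. sets \<mu> = sets (borel_on K) \<and> emeasure \<mu> K = 1}"

definition couplings ::
  "'a::topological_space set \<Rightarrow> 'a measure \<Rightarrow> 'a measure \<Rightarrow> ('a \<times> 'a) measure set" where
  "couplings K \<mu> \<nu> =
     {\<pi> \<in> borel_probs (K \<times> K). distr \<pi> (borel_on K) fst = \<mu> \<and> distr \<pi> (borel_on K) snd = \<nu>}"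

text \<open>Optimal transport cost on \<open>K\<close> for the cost function \<open>d(x,y)\<^sup>s\<close>. The distance has to be the one
  used in \<^const>\<open>neumann_limit\<close>: replacing \<open>d\<close> by \<open>2 d\<close> divides \<^const>\<open>neumann_limit\<close> by \<open>2\<^sup>s\<close>, so the
  duality with \<open>2 / neumann_limit d s U\<close> cannot hold for a cost that does not scale with \<open>d\<close>. For
  \<open>d = dist\<close> the cost is \<open>|x - y|\<^sup>s\<close>.\<close>

definition transport_cost ::
  "('a::topological_space \<Rightarrow> 'a \<Rightarrow> real) \<Rightarrow> real \<Rightarrow> 'a set \<Rightarrow> 'a measure \<Rightarrow> 'a measure \<Rightarrow> ennreal" where
  "transport_cost d s K \<mu> \<nu> =
     (INF \<pi> \<in> couplings K \<mu> \<nu>. \<integral>\<^sup>+z. ennreal (d (fst z) (snd z) powr s) \<partial>\<pi>)"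

end

theory Submission
  imports Defs "HOL-Probability.Giry_Monad"
begin

text \<open>Let \<open>D\<close> be the diameter of the closure of \<open>U\<close> with respect to \<open>d\<close>. Both sides of the
  duality equal \<open>D\<^sup>s\<close>. On the transport side no plan costs more than \<open>D\<^sup>s\<close>, and the difference of
  the Dirac measures at a diametral pair attains this value. On the eigenvalue side the limit is
  \<open>2 / D\<^sup>s\<close>: for the upper bound, test with a shifted and normalised distance function from an
  endpoint of a diametral pair; for the lower bound, a De Giorgi iteration on level sets shows that
  a function of bounded energy comes close to its maximum and to its minimum on sets of measure
  bounded below uniformly in \<open>p\<close>, and by the balance condition these extrema are almost opposite.
  So the energy is at least about \<open>2\<^sup>p / D\<^bsup>n + sp\<^esup>\<close>.\<close>

section \<open>Equivalent distances\<close>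

text \<open>The 2 in \<open>2 / D powr s\<close> is an oscillation. For large \<open>p\<close> the
  normalisation makes \<open>|u|\<close> reach almost 1, and the balance condition then forces
  values almost as far on the other side of 0; a difference of about 2 over a distance of at most
  \<open>D\<close> has a quotient of at least about \<open>2 / D powr s\<close>. For the test
  function the balancing shift depends on \<open>p\<close> and is not explicit, but one end of the
  range \<open>[0, D]\<close> of the distance function is at least \<open>D / 2\<close> away from
  it. Dividing by the norm then leaves a Lipschitz constant of about \<open>2 / D\<close>. Only
  exponential rates in \<open>p\<close> matter: both bounds are claimed for a base strictly off
  \<open>2 / D powr s\<close>, and the \<open>p\<close>-th power of a ratio below 1 beats every
  factor independent of \<open>p\<close>. So the obstacle is uniformity in \<open>p\<close>, not
  sharpness of constants. The two bounds together also yield convergence, which \<open>Lim\<close>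
  by itself does not assert. On the transport side no duality theorem is called for, since two Dirac
  measures have a single coupling.\<close>

lemma equivalent_distanceD:
  assumes "equivalent_distance d"
  shows "0 \<le> d x y" "d x y = d y x" "d x y = 0 \<longleftrightarrow> x = y" "d x z \<le> d x y + d y z"
proof -
  interpret Metric_space UNIV d
    using assms by (simp add: equivalent_distance_def)
  show "0 \<le> d x y" "d x y = d y x" "d x y = 0 \<longleftrightarrow> x = y" "d x z \<le> d x y + d y z"
    using commute triangle by auto
qed

lemma equivalent_distance_bounds:
  assumes "equivalent_distance d"
  obtains c C where "c > 0" "C > 0" "\<And>x y. c * dist x y \<le> d x y" "\<And>x y. d x y \<le> C * dist x y"
  using assms unfolding equivalent_distance_def by blast

lemma equivalent_distance_dist: "equivalent_distance dist"
  unfolding equivalent_distance_def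
proof (intro conjI exI[of _ 1] allI)
  show "Metric_space UNIV (dist :: 'a \<Rightarrow> 'a \<Rightarrow> real)"
    by (auto simp: Metric_space_def dist_commute dist_triangle)
qed auto

lemma continuous_on_equivalent_distance:
  assumes "equivalent_distance d"
  shows "continuous_on A (\<lambda>z. d (fst z) (snd z))"
proof -
  obtain C where C: "C > 0" "\<And>x y. d x y \<le> C * dist x y"
    using equivalent_distance_bounds[OF assms] by metis
  note d = equivalent_distanceD[OF assms]
  have "\<bar>d (fst z) (snd z) - d (fst w) (snd w)\<bar> \<le> (2 * C) * dist z w" for z w
  proof -
    have "\<bar>d (fst z) (snd z) - d (fst w) (snd w)\<bar> \<le> d (fst z) (fst w) + d (snd z) (snd w)"
      using d(4)[of "fst z" "snd z" "fst w"] d(4)[of "fst w" "snd z" "snd w"]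
        d(4)[of "fst w" "snd w" "fst z"] d(4)[of "fst z" "snd w" "snd z"]
        d(2)[of "fst z" "fst w"] d(2)[of "snd z" "snd w"] by linarith
    also have "\<dots> \<le> C * dist z w + C * dist z w"
      using C(2)[of "fst z" "fst w"] C(2)[of "snd z" "snd w"]
        mult_left_mono[OF dist_fst_le[of z w], of C] mult_left_mono[OF dist_snd_le[of z w], of C] C(1)
      by linarith
    finally show ?thesis by simp
  qed
  then have "(2 * C)-lipschitz_on A (\<lambda>z. d (fst z) (snd z))"
    using C(1) by (intro lipschitz_onI) (auto simp: dist_real_def)
  then show ?thesis
    by (rule lipschitz_on_continuous_on)
qed

lemma continuous_on_equivalent_distance_left:
  assumes "equivalent_distance d"
  shows "continuous_on A (\<lambda>x. d x z)"
proof -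
  have "continuous_on A (\<lambda>x. (x, z))"
    by (intro continuous_intros)
  then show ?thesis
    using continuous_on_compose2[OF continuous_on_equivalent_distance[OF assms, of UNIV],
        of A "\<lambda>x. (x, z)"] by simp
qed

section \<open>Optimal transport\<close>

lemma space_eq_of_sets_borel_on: "sets \<mu> = sets (borel_on K) \<Longrightarrow> space \<mu> = K"
  by (drule sets_eq_imp_space_eq) (simp add: space_restrict_space)

lemma borel_on_fst [measurable]: "fst \<in> borel_on (A \<times> B) \<rightarrow>\<^sub>M borel_on A"
  and borel_on_snd [measurable]: "snd \<in> borel_on (A \<times> B) \<rightarrow>\<^sub>M borel_on B"
  for A :: "'a::second_countable_topology set" and B :: "'b::second_countable_topology set"
  by (auto intro!: measurable_restrict_space3 simp: borel_prod[symmetric])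

text \<open>An infimum over the empty set is infinite in \<open>ennreal\<close>, so an upper bound
  on the transport cost requires some coupling; the product measure is one.\<close>

lemma couplings_nonempty:
  fixes K :: "'a::second_countable_topology set"
  assumes "\<mu> \<in> borel_probs K" "\<nu> \<in> borel_probs K"
  shows "couplings K \<mu> \<nu> \<noteq> {}"
proof -
  have sets: "sets \<mu> = sets (borel_on K)" "sets \<nu> = sets (borel_on K)"
    using assms by (auto simp: borel_probs_def)
  note sp = this[THEN space_eq_of_sets_borel_on]
  interpret M: prob_space \<mu>
    using assms sp by (intro prob_spaceI) (auto simp: borel_probs_def)
  interpret N: prob_space \<nu>
    using assms sp by (intro prob_spaceI) (auto simp: borel_probs_def)
  interpret P: pair_prob_space \<mu> \<nu> ..
  have id: "id \<in> \<mu> \<rightarrow>\<^sub>M borel" "id \<in> \<nu> \<rightarrow>\<^sub>M borel"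
    unfolding measurable_cong_sets[OF sets(1) refl] measurable_cong_sets[OF sets(2) refl]
    by (auto intro!: measurable_restrict_space1)
  have "(\<lambda>z. (id (fst z), id (snd z))) \<in> \<mu> \<Otimes>\<^sub>M \<nu> \<rightarrow>\<^sub>M borel"
    by (intro borel_measurable_Pair measurable_compose[OF measurable_fst id(1)]
        measurable_compose[OF measurable_snd id(2)])
  then have meas: "(\<lambda>z. z) \<in> \<mu> \<Otimes>\<^sub>M \<nu> \<rightarrow>\<^sub>M borel_on (K \<times> K)"
    by (intro measurable_restrict_space2) (auto simp: space_pair_measure sp)
  \<comment> \<open>Pushing the product measure forward by the identity replaces its product sigma
    algebra by the Borel sets of \<open>K \<times> K\<close>, as \<open>borel_probs\<close>
    demands.\<close>
  define \<pi> where "\<pi> = distr (\<mu> \<Otimes>\<^sub>M \<nu>) (borel_on (K \<times> K)) (\<lambda>z. z)"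
  have "prob_space \<pi>"
    unfolding \<pi>_def by (rule P.prob_space_distr[OF meas])
  moreover have "space \<pi> = K \<times> K"
    by (simp add: \<pi>_def space_restrict_space)
  ultimately have "emeasure \<pi> (K \<times> K) = 1"
    using prob_space.emeasure_space_1[of \<pi>] by simp
  moreover have "sets \<pi> = sets (borel_on (K \<times> K))"
    by (simp add: \<pi>_def)
  moreover have "distr \<pi> (borel_on K) fst = distr (\<mu> \<Otimes>\<^sub>M \<nu>) \<mu> fst"
    unfolding \<pi>_def by (subst distr_distr[OF _ meas]) (auto intro!: distr_cong simp: sets o_def)
  moreover have "distr \<pi> (borel_on K) snd = distr (\<mu> \<Otimes>\<^sub>M \<nu>) \<nu> snd"
    unfolding \<pi>_def by (subst distr_distr[OF _ meas]) (auto intro!: distr_cong simp: sets o_def)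
  moreover have "distr (\<mu> \<Otimes>\<^sub>M \<nu>) \<mu> fst = \<mu>"
    by (rule N.distr_pair_fst)
  moreover have "distr (\<mu> \<Otimes>\<^sub>M \<nu>) \<nu> snd = \<nu>"
  proof (rule measure_eqI)
    fix A assume "A \<in> sets (distr (\<mu> \<Otimes>\<^sub>M \<nu>) \<nu> snd)"
    then have A: "A \<in> sets \<nu>" by simp
    have "snd -` A \<inter> space (\<mu> \<Otimes>\<^sub>M \<nu>) = space \<mu> \<times> A"
      using sets.sets_into_space[OF A] by (auto simp: space_pair_measure)
    then show "emeasure (distr (\<mu> \<Otimes>\<^sub>M \<nu>) \<nu> snd) A = emeasure \<nu> A"
      using A by (simp add: emeasure_distr N.emeasure_pair_measure_Times M.emeasure_space_1)
  qed simp
  ultimately have "\<pi> \<in> couplings K \<mu> \<nu>"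
    by (simp add: couplings_def borel_probs_def)
  then show ?thesis by auto
qed

lemma transport_cost_le:
  fixes K :: "'a::second_countable_topology set"
  assumes "\<mu> \<in> borel_probs K" "\<nu> \<in> borel_probs K"
    and "\<And>x y. x \<in> K \<Longrightarrow> y \<in> K \<Longrightarrow> d x y powr s \<le> B"
  shows "transport_cost d s K \<mu> \<nu> \<le> ennreal B"
proof -
  obtain \<pi> where \<pi>: "\<pi> \<in> couplings K \<mu> \<nu>"
    using couplings_nonempty[OF assms(1,2)] by blast
  then have "sets \<pi> = sets (borel_on (K \<times> K))" "emeasure \<pi> (K \<times> K) = 1"
    by (auto simp: couplings_def borel_probs_def)
  then have sp: "space \<pi> = K \<times> K" and "emeasure \<pi> (space \<pi>) = 1"
    by (simp_all add: space_eq_of_sets_borel_on)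
  have "transport_cost d s K \<mu> \<nu> \<le> (\<integral>\<^sup>+z. ennreal (d (fst z) (snd z) powr s) \<partial>\<pi>)"
    unfolding transport_cost_def using \<pi> by (rule INF_lower)
  also have "\<dots> \<le> (\<integral>\<^sup>+z. ennreal B \<partial>\<pi>)"
    by (intro nn_integral_mono ennreal_leI assms(3)) (auto simp: sp)
  also have "\<dots> = ennreal B"
    using \<open>emeasure \<pi> (space \<pi>) = 1\<close> by simp
  finally show ?thesis .
qed

text \<open>Every coupling of two Dirac measures is concentrated at the single pair
  \<open>(x, y)\<close>, so all couplings have the same cost. The T1 axiom makes points Borel, which
  turns the marginal conditions into almost sure equalities.\<close>

lemma transport_cost_return_ge:
  fixes K :: "'a::{second_countable_topology, t1_space} set"
  assumes "x \<in> K" "y \<in> K"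
  shows "ennreal (d x y powr s) \<le> transport_cost d s K (return (borel_on K) x) (return (borel_on K) y)"
  unfolding transport_cost_def
proof (rule INF_greatest)
  fix \<pi> assume \<pi>: "\<pi> \<in> couplings K (return (borel_on K) x) (return (borel_on K) y)"
  then have sets: "sets \<pi> = sets (borel_on (K \<times> K))" and one: "emeasure \<pi> (K \<times> K) = 1"
    and mar: "distr \<pi> (borel_on K) fst = return (borel_on K) x"
      "distr \<pi> (borel_on K) snd = return (borel_on K) y"
    by (auto simp: couplings_def borel_probs_def)
  note sp = space_eq_of_sets_borel_on[OF sets]
  have [measurable]: "fst \<in> \<pi> \<rightarrow>\<^sub>M borel_on K" "snd \<in> \<pi> \<rightarrow>\<^sub>M borel_on K"
    unfolding measurable_cong_sets[OF sets refl] by measurable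
  have point: "{w \<in> space (borel_on K). w = z} \<in> sets (borel_on K)" if "z \<in> K" for z
  proof -
    have "{w \<in> space (borel_on K). w = z} = K \<inter> {z}"
      using that by (auto simp: space_restrict_space)
    then show ?thesis by (auto simp: sets_restrict_space)
  qed
  have "AE w in distr \<pi> (borel_on K) fst. w = x" "AE w in distr \<pi> (borel_on K) snd. w = y"
    unfolding mar using assms point by (auto simp: AE_return space_restrict_space pred_def)
  then have "AE z in \<pi>. fst z = x" "AE z in \<pi>. snd z = y"
    using assms point by (auto simp: AE_distr_iff)
  then have "AE z in \<pi>. ennreal (d x y powr s) = ennreal (d (fst z) (snd z) powr s)"
    by eventually_elim auto
  then have "(\<integral>\<^sup>+z. ennreal (d (fst z) (snd z) powr s) \<partial>\<pi>) = (\<integral>\<^sup>+z. ennreal (d x y powr s) \<partial>\<pi>)"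
    by (intro nn_integral_cong_AE) auto
  then show "ennreal (d x y powr s) \<le> (\<integral>\<^sup>+z. ennreal (d (fst z) (snd z) powr s) \<partial>\<pi>)"
    using one sp by simp
qed

definition dirac_difference :: "'a \<Rightarrow> 'a \<Rightarrow> 'a set \<Rightarrow> real" where
  "dirac_difference x y A = indicator A x - indicator A y"

lemma dirac_difference_signed: "dirac_difference x y \<in> signed_borel_measures K"
  unfolding signed_borel_measures_def mem_Collect_eq
proof (intro allI impI)
  fix A :: "nat \<Rightarrow> 'a set" assume "disjoint_family A"
  then have "(\<lambda>i. indicator (A i) z :: real) sums indicator (\<Union>i. A i) z" for z
    by (intro indicator_sums disjoint_family_onD) auto
  then show "(\<lambda>i. dirac_difference x y (A i)) sums dirac_difference x y (\<Union>i. A i)"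
    unfolding dirac_difference_def by (intro sums_diff)
qed

lemma sets_pos_part: "sets (pos_part K \<sigma>) = sets (borel_on K)"
  using sets.sets_measure_of_eq[of "borel_on K"]
  by (simp add: pos_part_def space_restrict_space)

text \<open>The supremum over Borel subsets of \<open>A\<close> is attained at
  \<open>A - {y}\<close>: removing \<open>y\<close> discards the negative mass, and \<open>x\<close>
  survives because \<open>x \<noteq> y\<close>.\<close>

lemma pos_part_dirac_difference:
  fixes x y :: "'a::t1_space"
  assumes "x \<noteq> y"
  shows "pos_part K (dirac_difference x y) = return (borel_on K) x"
proof -
  have sp: "space (borel_on K) = K" by (simp add: space_restrict_space)
  have "(SUP B \<in> {B \<in> sets (borel_on K). B \<subseteq> A}. ennreal (dirac_difference x y B)) = indicator A x"
    if A: "A \<in> sets (borel_on K)" for A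
  proof (rule antisym)
    show "(SUP B \<in> {B \<in> sets (borel_on K). B \<subseteq> A}. ennreal (dirac_difference x y B)) \<le> indicator A x"
      by (rule SUP_least) (auto simp: dirac_difference_def indicator_def ennreal_neg)
    have eq: "A - {y} = A \<inter> (K \<inter> - {y})"
      using sets.sets_into_space[OF A] by (auto simp: sp)
    have "K \<inter> - {y} \<in> sets (borel_on K)"
      unfolding sets_restrict_space by (intro imageI) auto
    then have "A - {y} \<in> {B \<in> sets (borel_on K). B \<subseteq> A}"
      unfolding eq using A by auto
    then have "ennreal (dirac_difference x y (A - {y})) \<le>
        (SUP B \<in> {B \<in> sets (borel_on K). B \<subseteq> A}. ennreal (dirac_difference x y B))"
      by (rule SUP_upper)
    moreover have "ennreal (dirac_difference x y (A - {y})) = indicator A x"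
      using assms by (auto simp: dirac_difference_def indicator_def)
    ultimately show "indicator A x \<le>
        (SUP B \<in> {B \<in> sets (borel_on K). B \<subseteq> A}. ennreal (dirac_difference x y B))"
      by simp
  qed
  moreover have "sigma_sets K (sets (borel_on K)) = sets (borel_on K)"
    using sets.sigma_sets_eq[of "borel_on K"] by (simp add: sp)
  ultimately show ?thesis
    unfolding pos_part_def return_def sp
    by (intro measure_of_eq) (use sets.space_closed[of "borel_on K"] sp in auto)
qed

lemma neg_part_dirac_difference:
  fixes x y :: "'a::t1_space"
  assumes "x \<noteq> y"
  shows "neg_part K (dirac_difference x y) = return (borel_on K) y"
proof -
  have "(\<lambda>A. - dirac_difference x y A) = dirac_difference y x"
    by (auto simp: dirac_difference_def)
  then show ?thesis
    using pos_part_dirac_difference[of y x K] assms by (simp add: neg_part_def)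
qed

lemma transport_cost_maximum:
  fixes K :: "'a::{second_countable_topology, t1_space} set"
  assumes "x \<in> K" "y \<in> K" "x \<noteq> y"
    and max: "\<And>x' y'. x' \<in> K \<Longrightarrow> y' \<in> K \<Longrightarrow> d x' y' powr s \<le> d x y powr s"
  defines "W \<equiv> {transport_cost d s K (pos_part K \<sigma>) (neg_part K \<sigma>) |\<sigma>.
      \<sigma> \<in> signed_borel_measures K \<and> emeasure (pos_part K \<sigma>) K = 1 \<and> emeasure (neg_part K \<sigma>) K = 1}"
  shows "ennreal (d x y powr s) \<in> W" "\<forall>w\<in>W. w \<le> ennreal (d x y powr s)"
proof -
  have le: "transport_cost d s K (pos_part K \<sigma>) (neg_part K \<sigma>) \<le> ennreal (d x y powr s)"
    if "emeasure (pos_part K \<sigma>) K = 1" "emeasure (neg_part K \<sigma>) K = 1" for \<sigma>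
    using that
    by (intro transport_cost_le max) (auto simp: borel_probs_def sets_pos_part neg_part_def)
  then show "\<forall>w\<in>W. w \<le> ennreal (d x y powr s)"
    by (auto simp: W_def)
  define \<sigma> where "\<sigma> = dirac_difference x y"
  have parts: "pos_part K \<sigma> = return (borel_on K) x" "neg_part K \<sigma> = return (borel_on K) y"
    by (simp_all add: \<sigma>_def pos_part_dirac_difference neg_part_dirac_difference assms)
  have "K \<in> sets (borel_on K)"
    using sets.top[of "borel_on K"] by (simp add: space_restrict_space)
  then have one: "emeasure (pos_part K \<sigma>) K = 1" "emeasure (neg_part K \<sigma>) K = 1"
    using assms by (auto simp: parts)
  have "transport_cost d s K (pos_part K \<sigma>) (neg_part K \<sigma>) = ennreal (d x y powr s)"
    using le[OF one] transport_cost_return_ge[OF assms(1,2), of d s] by (simp add: parts)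
  moreover have "\<sigma> \<in> signed_borel_measures K"
    by (simp add: \<sigma>_def dirac_difference_signed)
  ultimately show "ennreal (d x y powr s) \<in> W"
    unfolding W_def using one by force
qed

section \<open>Measure density of smooth domains\<close>

text \<open>Smoothness gives continuity of the derivative only in each fixed direction. Compactness
  bounds the finitely many basis directions, and their sum bounds the operator norm; the mean value
  inequality on the convex ball does the rest.\<close>

lemma smooth_fun_lipschitz_on_cball:
  fixes g :: "'a::euclidean_space \<Rightarrow> real"
  assumes "smooth_fun g"
  shows "\<exists>L\<ge>0. \<forall>x\<in>cball a r. \<forall>y\<in>cball a r. \<bar>g x - g y\<bar> \<le> L * norm (x - y)"
proof -
  have "k_times_cont_diff 1 g"
    using assms by (simp add: smooth_fun_def)
  then have diff: "g differentiable (at x)"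
    and cont: "continuous_on UNIV (\<lambda>x. frechet_derivative g (at x) v)" for x v
    by auto
  have "\<exists>M\<ge>0. \<forall>x\<in>cball a r. \<bar>frechet_derivative g (at x) v\<bar> \<le> M" for v
  proof -
    have "compact ((\<lambda>x. frechet_derivative g (at x) v) ` cball a r)"
      by (intro compact_continuous_image continuous_on_subset[OF cont]) auto
    then obtain M where M: "\<And>x. x \<in> cball a r \<Longrightarrow> \<bar>frechet_derivative g (at x) v\<bar> \<le> M"
      by (force dest!: compact_imp_bounded simp: bounded_iff)
    then have "\<forall>x\<in>cball a r. \<bar>frechet_derivative g (at x) v\<bar> \<le> max 0 M"
      by fastforce
    then show ?thesis
      by (intro exI[of _ "max 0 M"]) auto
  qed
  then obtain M where M: "\<And>v. 0 \<le> M v"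
    "\<And>v x. x \<in> cball a r \<Longrightarrow> \<bar>frechet_derivative g (at x) v\<bar> \<le> M v"
    by metis
  define L where "L = (\<Sum>b\<in>Basis. M b)"
  have "onorm (frechet_derivative g (at x)) \<le> L" if x: "x \<in> cball a r" for x
  proof (rule onorm_le)
    fix h :: 'a
    have lin: "linear (frechet_derivative g (at x))"
      using diff by (rule linear_frechet_derivative)
    have "frechet_derivative g (at x) h = frechet_derivative g (at x) (\<Sum>b\<in>Basis. (h \<bullet> b) *\<^sub>R b)"
      by (simp add: euclidean_representation)
    also have "\<dots> = (\<Sum>b\<in>Basis. (h \<bullet> b) * frechet_derivative g (at x) b)"
      using lin by (simp add: linear_sum linear_cmul)
    also have "\<bar>\<dots>\<bar> \<le> (\<Sum>b\<in>Basis. \<bar>(h \<bullet> b) * frechet_derivative g (at x) b\<bar>)"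
      by (rule sum_abs)
    also have "\<dots> \<le> (\<Sum>b\<in>Basis. M b * norm h)"
      using M x by (intro sum_mono) (subst mult.commute, auto simp: abs_mult intro!: mult_mono Basis_le_norm)
    finally show "norm (frechet_derivative g (at x) h) \<le> L * norm h"
      by (simp add: L_def sum_distrib_right)
  qed
  then have "norm (g x - g y) \<le> L * norm (x - y)" if "x \<in> cball a r" "y \<in> cball a r" for x y
    using diff that
    by (intro differentiable_bound[of "cball a r" g "\<lambda>x. frechet_derivative g (at x)"])
      (auto intro: has_derivative_at_withinI simp: frechet_derivative_works)
  moreover have "L \<ge> 0"
    unfolding L_def using M by (simp add: sum_nonneg)
  ultimately show ?thesis
    by auto
qed

lemma norm_minus_projection_le:
  fixes v e :: "'a::real_inner"
  assumes "norm e = 1"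
  shows "norm (v - (v \<bullet> e) *\<^sub>R e) \<le> norm v"
proof -
  have "e \<bullet> e = 1"
    using assms by (simp add: norm_eq_1)
  then have "(norm (v - (v \<bullet> e) *\<^sub>R e))\<^sup>2 = (norm v)\<^sup>2 - (v \<bullet> e)\<^sup>2"
    unfolding power2_norm_eq_inner
    by (simp add: algebra_simps power2_eq_square inner_commute)
  then have "(norm (v - (v \<bullet> e) *\<^sub>R e))\<^sup>2 \<le> (norm v)\<^sup>2"
    by simp
  then show ?thesis
    by (rule power2_le_imp_le) simp
qed

text \<open>Interior corkscrew condition, with constants uniform near \<open>x0\<close>. At a
  boundary point the domain lies above a Lipschitz graph, so moving from \<open>x\<close> upwards by
  \<open>\<rho>/2\<close> leaves room for a ball of radius proportional to
  \<open>\<rho>\<close>.\<close>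

lemma smooth_boundary_corkscrew:
  fixes U :: "'a::euclidean_space set"
  assumes "open U" "smooth_boundary U" "x0 \<in> closure U"
  shows "\<exists>r>0. \<exists>\<kappa>>0. \<forall>x\<in>U \<inter> ball x0 r. \<forall>\<rho>. 0 < \<rho> \<and> \<rho> \<le> r \<longrightarrow>
    (\<exists>y. ball y (\<kappa> * \<rho>) \<subseteq> U \<inter> ball x \<rho>)"
proof (cases "x0 \<in> U")
  case True
  then obtain r where r: "r > 0" "ball x0 r \<subseteq> U"
    using \<open>open U\<close> by (auto simp: open_contains_ball)
  have "\<exists>y. ball y (1 * \<rho>) \<subseteq> U \<inter> ball x \<rho>" if "x \<in> ball x0 (r/2)" "\<rho> \<le> r/2" for x \<rho>
  proof -
    have "dist x0 w < r" if "dist x w < \<rho>" for w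
      using that \<open>x \<in> ball x0 (r/2)\<close> \<open>\<rho> \<le> r/2\<close> dist_triangle[of x0 w x] by simp
    then have "ball x \<rho> \<subseteq> ball x0 r"
      by auto
    then show ?thesis using r by (intro exI[of _ x]) auto
  qed
  then show ?thesis
    using r(1) by - (rule exI[of _ "r/2"], rule conjI, simp, rule exI[of _ 1], simp)
next
  case False
  then have "x0 \<in> frontier U"
    using assms by (simp add: frontier_def interior_open)
  then obtain r e g where r: "r > 0" and e: "norm e = 1" and g: "smooth_fun g"
    and U: "U \<inter> ball x0 r = {x \<in> ball x0 r. g (x - (x \<bullet> e) *\<^sub>R e) < x \<bullet> e}"
    using assms(2) unfolding smooth_boundary_def by meson
  define P where "P x = x - (x \<bullet> e) *\<^sub>R e" for x
  have P_diff: "P x - P y = P (x - y)" for x y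
    by (simp add: P_def algebra_simps)
  have P_norm: "norm (P v) \<le> norm v" for v
    unfolding P_def using e by (rule norm_minus_projection_le)
  have ee: "e \<bullet> e = 1"
    using e by (simp add: norm_eq_1)
  obtain L where L: "L \<ge> 0"
    "\<And>x y. x \<in> cball (P x0) r \<Longrightarrow> y \<in> cball (P x0) r \<Longrightarrow> \<bar>g x - g y\<bar> \<le> L * norm (x - y)"
    using smooth_fun_lipschitz_on_cball[OF g] by meson
  \<comment> \<open>Inside the small ball the height changes by less than
    \<open>\<kappa> * \<rho>\<close> and the graph by at most \<open>L * \<kappa> * \<rho>\<close>;
    together this is \<open>\<rho>/4\<close>, less than the upward shift
    \<open>\<rho>/2\<close>.\<close>
  define \<kappa> where "\<kappa> = 1 / (4 * (1 + L))"
  have \<kappa>: "\<kappa> > 0" "\<kappa> \<le> 1/4" "\<kappa> + L * \<kappa> = 1/4"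
    using L(1) by (auto simp: \<kappa>_def field_simps)
  have "ball (x + (\<rho>/2) *\<^sub>R e) (\<kappa> * \<rho>) \<subseteq> U \<inter> ball x \<rho>"
    if x: "x \<in> U" "x \<in> ball x0 (r/2)" and \<rho>: "0 < \<rho>" "\<rho> \<le> r/2" for x \<rho>
  proof
    fix w assume w: "w \<in> ball (x + (\<rho>/2) *\<^sub>R e) (\<kappa> * \<rho>)"
    define v where "v = w - (x + (\<rho>/2) *\<^sub>R e)"
    have w_eq: "w = x + (\<rho>/2) *\<^sub>R e + v"
      by (simp add: v_def)
    have v: "norm v < \<kappa> * \<rho>"
      using w by (simp add: v_def dist_norm norm_minus_commute)
    have "norm (w - x) \<le> norm ((\<rho>/2) *\<^sub>R e) + norm v"
      unfolding w_eq using norm_triangle_ineq[of "(\<rho>/2) *\<^sub>R e" v] by (simp add: algebra_simps)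
    also have "\<dots> < \<rho>/2 + \<kappa> * \<rho>"
      using v \<rho> e by simp
    also have "\<dots> \<le> \<rho>"
      using mult_right_mono[OF \<kappa>(2), of \<rho>] \<rho> by linarith
    finally have wx: "norm (w - x) < \<rho>" .
    then have w_ball: "w \<in> ball x0 r"
      using x(2) \<rho> dist_triangle[of x0 w x] by (simp add: dist_norm norm_minus_commute)
    have x_ball: "x \<in> ball x0 r"
      using x(2) r by simp
    have "P z \<in> cball (P x0) r" if "z \<in> ball x0 r" for z
      using that P_norm[of "x0 - z"] by (simp add: dist_norm P_diff)
    then have "\<bar>g (P w) - g (P x)\<bar> \<le> L * norm (P w - P x)"
      using L(2) w_ball x_ball by blast
    also have "P w - P x = P v"
      by (simp add: P_def w_eq inner_add_left algebra_simps ee)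
    finally have "g (P w) \<le> g (P x) + L * norm (P v)"
      by linarith
    moreover have "L * norm (P v) \<le> L * (\<kappa> * \<rho>)"
      using P_norm[of v] v L(1) by (intro mult_left_mono) auto
    moreover have "g (P x) < x \<bullet> e"
      using x x_ball U unfolding P_def by blast
    moreover have "L * (\<kappa> * \<rho>) + \<kappa> * \<rho> = (\<kappa> + L * \<kappa>) * \<rho>"
      by (simp add: algebra_simps)
    moreover have "(\<kappa> + L * \<kappa>) * \<rho> < \<rho>/2"
      unfolding \<kappa>(3) using \<rho> by simp
    moreover have "\<bar>v \<bullet> e\<bar> < \<kappa> * \<rho>"
      using Cauchy_Schwarz_ineq2[of v e] v e by simp
    moreover have "w \<bullet> e = x \<bullet> e + \<rho>/2 + v \<bullet> e"
      by (simp add: w_eq inner_add_left ee)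
    ultimately have "g (P w) < w \<bullet> e"
      by linarith
    then show "w \<in> U \<inter> ball x \<rho>"
      using w_ball wx U by (auto simp: P_def dist_norm norm_minus_commute)
  qed
  then have "\<exists>y. ball y (\<kappa> * \<rho>) \<subseteq> U \<inter> ball x \<rho>"
    if "x \<in> U" "x \<in> ball x0 (r/2)" "0 < \<rho>" "\<rho> \<le> r/2" for x \<rho>
    using that by blast
  then show ?thesis
    using r \<kappa>(1) by - (rule exI[of _ "r/2"], rule conjI, simp, rule exI[of _ \<kappa>], simp)
qed

text \<open>Compactness of the closure reduces the local corkscrew constants to finitely many, whose
  minima are positive; the inscribed ball then supplies the volume.\<close>

lemma smooth_bounded_domain_measure_density:
  fixes U :: "'a::euclidean_space set"
  assumes "smooth_bounded_domain U"
  obtains r0 c where "r0 > 0" "c > 0"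
    "\<And>x \<rho>. x \<in> U \<Longrightarrow> 0 < \<rho> \<Longrightarrow> \<rho> \<le> r0 \<Longrightarrow> c * \<rho> ^ DIM('a) \<le> measure lebesgue (U \<inter> ball x \<rho>)"
proof -
  have U: "open U" "bounded U" "smooth_boundary U" "U \<noteq> {}"
    using assms by (auto simp: smooth_bounded_domain_def)
  obtain r \<kappa> where r: "\<And>x. x \<in> closure U \<Longrightarrow> r x > 0" and \<kappa>: "\<And>x. x \<in> closure U \<Longrightarrow> \<kappa> x > 0"
    and cork: "\<And>x0 x \<rho>. x0 \<in> closure U \<Longrightarrow> x \<in> U \<inter> ball x0 (r x0) \<Longrightarrow> 0 < \<rho> \<Longrightarrow> \<rho> \<le> r x0
      \<Longrightarrow> \<exists>y. ball y (\<kappa> x0 * \<rho>) \<subseteq> U \<inter> ball x \<rho>"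
    using smooth_boundary_corkscrew[OF U(1,3)] by metis
  have "closure U \<subseteq> (\<Union>x\<in>closure U. ball x (r x))"
    using r by force
  then obtain F where F: "F \<subseteq> closure U" "finite F" "closure U \<subseteq> (\<Union>x\<in>F. ball x (r x))"
    using compactE_image[of "closure U" "closure U" "\<lambda>x. ball x (r x)"] U(2)
    by (metis compact_closure open_ball)
  then have "F \<noteq> {}"
    using U(4) by auto
  define r0 where "r0 = Min (r ` F)"
  define k where "k = Min (\<kappa> ` F)"
  have pos: "r0 > 0" "k > 0"
    using F r \<kappa> \<open>F \<noteq> {}\<close> by (auto simp: r0_def k_def)
  define c where "c = k ^ DIM('a) * measure lborel (ball (0::'a) 1)"
  have "c * \<rho> ^ DIM('a) \<le> measure lebesgue (U \<inter> ball x \<rho>)"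
    if x: "x \<in> U" and \<rho>: "0 < \<rho>" "\<rho> \<le> r0" for x \<rho>
  proof -
    have "x \<in> closure U"
      using x closure_subset by auto
    then obtain x0 where x0: "x0 \<in> F" "x \<in> ball x0 (r x0)"
      using F(3) by auto
    have le: "r0 \<le> r x0" "k \<le> \<kappa> x0"
      using F(2) x0 by (auto simp: r0_def k_def)
    obtain y where y: "ball y (\<kappa> x0 * \<rho>) \<subseteq> U \<inter> ball x \<rho>"
      using cork[of x0 x \<rho>] x0 F(1) x \<rho> le by auto
    have "ball y (k * \<rho>) \<subseteq> ball y (\<kappa> x0 * \<rho>)"
      using le \<rho> by (intro subset_ball mult_right_mono) auto
    then have sub: "ball y (k * \<rho>) \<subseteq> U \<inter> ball x \<rho>"
      using y by blast
    have "c * \<rho> ^ DIM('a) = measure lborel (ball y (k * \<rho>))"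
      using \<rho> pos content_ball_conv_unit_ball[of "k * \<rho>" y] by (simp add: c_def power_mult_distrib)
    also have "\<dots> = measure lebesgue (ball y (k * \<rho>))"
      by simp
    also have "\<dots> \<le> measure lebesgue (U \<inter> ball x \<rho>)"
      using sub U by (intro measure_mono_fmeasurable) (auto intro!: lmeasurable_open)
    finally show ?thesis .
  qed
  moreover have "c > 0"
    using pos content_ball_pos[of 1 "0::'a"] by (simp add: c_def)
  ultimately show ?thesis
    using that pos by blast
qed

section \<open>Level sets of functions of bounded energy\<close>

text \<open>A Chebyshev bound on the pairs with \<open>x \<in> A\<close> and
  \<open>y \<in> B x\<close>. The fibre may vary with \<open>x\<close>: it is cut out of a ball
  around \<open>x\<close> in the level set iteration, and is a fixed set in the eigenvalue
  bound.\<close>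

lemma gagliardo_ge:
  fixes U :: "'a::euclidean_space set"
  assumes "A \<in> sets (lebesgue_on U)" "0 \<le> h" "0 \<le> b"
    and fin: "finite_measure (lebesgue_on U)"
    and B: "\<And>x. x \<in> A \<Longrightarrow> B x \<in> sets (lebesgue_on U)" "\<And>x. x \<in> A \<Longrightarrow> b \<le> measure (lebesgue_on U) (B x)"
    and le: "\<And>x y. x \<in> A \<Longrightarrow> y \<in> B x \<Longrightarrow>
      h \<le> \<bar>u x - u y\<bar> powr p / d x y powr (real DIM('a) + s * p)"
  shows "ennreal (h * b * measure (lebesgue_on U) A) \<le> gagliardo d s p U u"
proof -
  interpret finite_measure "lebesgue_on U" by (rule fin)
  let ?M = "lebesgue_on U"
  let ?f = "\<lambda>x y. ennreal (\<bar>u x - u y\<bar> powr p / d x y powr (real DIM('a) + s * p))"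
  have inner: "ennreal (h * b) \<le> (\<integral>\<^sup>+y. ?f x y \<partial>?M)" if "x \<in> A" for x
  proof -
    have "ennreal (h * b) \<le> ennreal (h * measure ?M (B x))"
      using B(2)[OF that] assms by (intro ennreal_leI mult_left_mono) auto
    also have "\<dots> = (\<integral>\<^sup>+y. ennreal h * indicator (B x) y \<partial>?M)"
      using B(1)[OF that] assms by (simp add: nn_integral_cmult_indicator emeasure_eq_measure ennreal_mult)
    also have "\<dots> \<le> (\<integral>\<^sup>+y. ?f x y \<partial>?M)"
      using le[OF that] by (intro nn_integral_mono) (auto simp: indicator_def intro!: ennreal_leI)
    finally show ?thesis .
  qed
  have "ennreal (h * b * measure ?M A) = (\<integral>\<^sup>+x. ennreal (h * b) * indicator A x \<partial>?M)"
    using assms by (simp add: nn_integral_cmult_indicator emeasure_eq_measure flip: ennreal_mult)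
  also have "\<dots> \<le> (\<integral>\<^sup>+x. (\<integral>\<^sup>+y. ?f x y \<partial>?M) \<partial>?M)"
    using inner by (intro nn_integral_mono) (auto simp: indicator_def)
  finally show ?thesis
    by (simp add: gagliardo_def)
qed

lemma sets_lebesgue_on_level [measurable]:
  fixes u :: "'a::euclidean_space \<Rightarrow> real"
  assumes [measurable]: "u \<in> borel_measurable (lebesgue_on U)"
  shows "{x \<in> U. t < u x} \<in> sets (lebesgue_on U)" "{x \<in> U. t \<le> u x} \<in> sets (lebesgue_on U)"
    "{x \<in> U. u x \<le> t} \<in> sets (lebesgue_on U)" "{x \<in> U. u x < t} \<in> sets (lebesgue_on U)"
proof -
  have "{x \<in> space (lebesgue_on U). t < u x} \<in> sets (lebesgue_on U)"
    "{x \<in> space (lebesgue_on U). t \<le> u x} \<in> sets (lebesgue_on U)"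
    "{x \<in> space (lebesgue_on U). u x \<le> t} \<in> sets (lebesgue_on U)"
    "{x \<in> space (lebesgue_on U). u x < t} \<in> sets (lebesgue_on U)"
    by measurable
  then show "{x \<in> U. t < u x} \<in> sets (lebesgue_on U)" "{x \<in> U. t \<le> u x} \<in> sets (lebesgue_on U)"
    "{x \<in> U. u x \<le> t} \<in> sets (lebesgue_on U)" "{x \<in> U. u x < t} \<in> sets (lebesgue_on U)"
    by simp_all
qed

lemma smooth_bounded_domain_lmeasurable:
  "smooth_bounded_domain U \<Longrightarrow> U \<in> lmeasurable"
  by (auto simp: smooth_bounded_domain_def intro!: lmeasurable_open)

text \<open>If \<open>u\<close> exceeds \<open>t'\<close> only on measure \<open>V\<close>, then
  around each point with \<open>u > t\<close> at least half of the guaranteed mass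
  \<open>2 * V\<close> of the ball lies in \<open>u \<le> t'\<close>. These pairs have a drop of at
  least \<open>t - t'\<close> over a \<open>d\<close>-distance of at most
  \<open>C * R\<close>.\<close>

lemma gagliardo_level_step:
  fixes U :: "'a::euclidean_space set"
  assumes U: "U \<in> lmeasurable" and u [measurable]: "u \<in> borel_measurable (lebesgue_on U)"
    and d: "equivalent_distance d" "\<And>x y. d x y \<le> C * dist x y" "C > 0"
    and dens: "\<And>x. x \<in> U \<Longrightarrow> 2 * V \<le> measure lebesgue (U \<inter> ball x R)"
    and "R > 0" "V \<ge> 0" "p > 0" "s > 0" "t' < t"
    and small: "measure (lebesgue_on U) {x \<in> U. t' < u x} \<le> V"
  shows "ennreal ((t - t') powr p / (C * R) powr (real DIM('a) + s * p) * V *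
      measure (lebesgue_on U) {x \<in> U. t < u x}) \<le> gagliardo d s p U u"
proof (rule gagliardo_ge[where B = "\<lambda>x. {y \<in> U. u y \<le> t'} \<inter> ball x R"])
  show fin: "finite_measure (lebesgue_on U)"
    using U by (rule finite_measure_lebesgue_on)
  interpret finite_measure "lebesgue_on U" by (rule fin)
  show "{x \<in> U. t < u x} \<in> sets (lebesgue_on U)"
    by measurable
  have ball: "U \<inter> ball x R \<in> sets (lebesgue_on U)" for x
    using U by (subst sets_restrict_space_iff) auto
  show meas: "{y \<in> U. u y \<le> t'} \<inter> ball x R \<in> sets (lebesgue_on U)" for x
  proof -
    have "{y \<in> U. u y \<le> t'} \<inter> ball x R = {y \<in> U. u y \<le> t'} \<inter> (U \<inter> ball x R)"
      by auto
    also have "\<dots> \<in> sets (lebesgue_on U)"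
      by (intro sets.Int sets_lebesgue_on_level u ball)
    finally show ?thesis .
  qed
  show "V \<le> measure (lebesgue_on U) ({y \<in> U. u y \<le> t'} \<inter> ball x R)" if "x \<in> {x \<in> U. t < u x}" for x
  proof -
    have "2 * V \<le> measure lebesgue (U \<inter> ball x R)"
      using dens that by auto
    also have "\<dots> = measure (lebesgue_on U) (U \<inter> ball x R)"
      using U by (subst measure_restrict_space) auto
    also have "\<dots> \<le> measure (lebesgue_on U) (({y \<in> U. u y \<le> t'} \<inter> ball x R) \<union> {x \<in> U. t' < u x})"
      using ball meas by (intro finite_measure_mono sets.Un) auto
    also have "\<dots> \<le> measure (lebesgue_on U) ({y \<in> U. u y \<le> t'} \<inter> ball x R) + V"
      using small meas by (intro order_trans[OF measure_Un_le] add_mono) auto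
    finally show ?thesis by simp
  qed
  fix x y assume x: "x \<in> {x \<in> U. t < u x}" and y: "y \<in> {y \<in> U. u y \<le> t'} \<inter> ball x R"
  \<comment> \<open>On the diagonal the quotient would be \<open>0 / 0 = 0\<close>, and the lower
    bound would fail.\<close>
  have "x \<noteq> y"
    using x y \<open>t' < t\<close> by auto
  then have pos: "d x y > 0"
    using equivalent_distanceD(1,3)[OF d(1), of x y] by auto
  have "d x y \<le> C * R"
  proof -
    have "C * dist x y \<le> C * R"
      using y d(3) by (intro mult_left_mono) auto
    then show ?thesis
      using d(2)[of x y] by linarith
  qed
  moreover have "t - t' \<le> \<bar>u x - u y\<bar>"
    using x y by auto
  ultimately show "(t - t') powr p / (C * R) powr (real DIM('a) + s * p)
      \<le> \<bar>u x - u y\<bar> powr p / d x y powr (real DIM('a) + s * p)"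
    using pos assms by (intro frac_le powr_mono2) auto
qed (use assms in auto)

text \<open>De Giorgi's iteration, along the levels \<open>a - \<epsilon> / 2\<^sup>k\<close> and the radii \<open>R0 * q\<^sup>k\<close>. It
  replaces Morrey's inequality. That \<open>\<eta>\<close> does not depend on \<open>p\<close> is essential for the limit
  \<open>p \<rightarrow> \<infinity>\<close>.\<close>

lemma gagliardo_level_sets:
  fixes U :: "'a::euclidean_space set"
  assumes U: "smooth_bounded_domain U" and d: "equivalent_distance d"
    and "s > 0" "\<epsilon> > 0" "\<Lambda> > 0"
  shows "\<exists>\<eta>>0. \<exists>p0>0. \<forall>p\<ge>p0. \<forall>u\<in>borel_measurable (lebesgue_on U). \<forall>a.
    gagliardo d s p U u \<le> ennreal (\<Lambda> powr p) \<longrightarrow>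
    measure (lebesgue_on U) {x \<in> U. a - \<epsilon> < u x} \<le> \<eta> \<longrightarrow>
    measure (lebesgue_on U) {x \<in> U. a \<le> u x} = 0"
proof -
  let ?M = "lebesgue_on U" and ?n = "real DIM('a)"
  have Um: "U \<in> lmeasurable"
    using U by (rule smooth_bounded_domain_lmeasurable)
  interpret finite_measure ?M
    using Um by (rule finite_measure_lebesgue_on)
  obtain C where C: "C > 0" "\<And>x y. d x y \<le> C * dist x y"
    using equivalent_distance_bounds[OF d] by metis
  obtain r0 c where r0: "r0 > 0" "c > 0"
    and dens: "\<And>x \<rho>. x \<in> U \<Longrightarrow> 0 < \<rho> \<Longrightarrow> \<rho> \<le> r0 \<Longrightarrow> c * \<rho> ^ DIM('a) \<le> measure lebesgue (U \<inter> ball x \<rho>)"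
    using smooth_bounded_domain_measure_density[OF U] by metis
  \<comment> \<open>The level gaps halve while the radii to the power \<open>s\<close> shrink by 4,
    so the ratio of gap to \<open>(C * R k) powr s\<close> doubles at every step.\<close>
  define q where "q = (1/4 :: real) powr (1/s)"
  have q: "q > 0" "q < 1" "q powr s = 1/4"
    using \<open>s > 0\<close> powr_less_mono2[of "1/s" "1/4" 1] by (auto simp: q_def powr_powr)
  have qn: "q ^ DIM('a) = (1/2) powr (2 * ?n / s)"
  proof -
    have "q ^ DIM('a) = q powr ?n"
      using q by (simp add: powr_realpow)
    also have "\<dots> = ((1/2) powr 2) powr (?n / s)"
      by (simp add: q_def powr_powr power2_eq_square)
    also have "\<dots> = (1/2) powr (2 * ?n / s)"
      by (subst powr_powr) simp
    finally show ?thesis .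
  qed
  \<comment> \<open>The second entry starts the iteration with a ratio of gap to
    \<open>(C * R0) powr s\<close> of at least \<open>2 * \<Lambda>\<close>, the first gap being
    \<open>\<epsilon> / 2\<close>; the first entry keeps the radii within reach of the density
    bound.\<close>
  define R0 where "R0 = min r0 ((\<epsilon> / (4 * \<Lambda>)) powr (1/s) / C)"
  have R0: "R0 > 0" "R0 \<le> r0"
    using r0 C assms by (auto simp: R0_def)
  have "C * R0 \<le> (\<epsilon> / (4 * \<Lambda>)) powr (1/s)"
    using C by (auto simp: R0_def min_def field_simps)
  then have "(C * R0) powr s \<le> ((\<epsilon> / (4 * \<Lambda>)) powr (1/s)) powr s"
    using C R0 \<open>s > 0\<close> by (intro powr_mono2) auto
  then have CR0: "(C * R0) powr s \<le> \<epsilon> / (4 * \<Lambda>)"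
    using assms by (simp add: powr_powr)
  define R where "R k = R0 * q ^ k" for k :: nat
  \<comment> \<open>Half the guaranteed mass of a ball of radius \<open>R k\<close>, to fit the
    \<open>2 * V\<close> of \<open>gagliardo_level_step\<close>. The final \<open>\<eta>\<close> is
    \<open>V 0\<close>.\<close>
  define V where "V k = c * R k ^ DIM('a) / 2" for k :: nat
  have R: "R k > 0" "R k \<le> r0" for k
  proof -
    show "R k > 0" using R0 q by (simp add: R_def)
    have "R k \<le> R0 * 1"
      unfolding R_def using R0 q by (intro mult_left_mono power_le_one) auto
    then show "R k \<le> r0" using R0 by simp
  qed
  have V: "V k > 0" for k
    using R[of k] r0 by (simp add: V_def)
  have V_eq: "V k = V 0 * (q ^ DIM('a)) ^ k" for k
    by (simp add: V_def R_def power_mult_distrib flip: power_mult) (simp add: mult.commute)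
  \<comment> \<open>The factor with \<open>V k = (C * R k) powr n / A\<close>, where
    \<open>n\<close> is the dimension: it lets \<open>V k\<close> cancel the dimensional part of the
    kernel.\<close>
  define A where "A = 2 * C powr ?n / c"
  have A: "A > 0"
    using C r0 by (simp add: A_def)
  obtain N where N: "(1/2 :: real) ^ N < V 0 / A"
    using real_arch_pow_inv[of "V 0 / A" "1/2"] V[of 0] A by auto
  \<comment> \<open>The step yields measures of order \<open>A * (1/2) powr (p * k)\<close>, which
    have to stay below \<open>V k\<close>. The first summand produces the decay rate
    \<open>q ^ DIM('a)\<close> of \<open>V k\<close>, and \<open>N\<close> absorbs the prefactor
    \<open>A / V 0\<close>.\<close>
  define p0 where "p0 = 2 * ?n / s + real N"
  have p0: "p0 > 0"
    using \<open>s > 0\<close> by (auto simp: p0_def intro!: add_pos_nonneg)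
  have null: "measure ?M {x \<in> U. a \<le> u x} = 0"
    if p: "p0 \<le> p" and u [measurable]: "u \<in> borel_measurable ?M"
      and g: "gagliardo d s p U u \<le> ennreal (\<Lambda> powr p)"
      and start: "measure ?M {x \<in> U. a - \<epsilon> < u x} \<le> V 0" for p u a
  proof -
    define t where "t k = a - \<epsilon> / 2 ^ k" for k :: nat
    define G where "G k = measure ?M {x \<in> U. t k < u x}" for k
    have "p > 0" using p p0 by simp
    \<comment> \<open>The invariant is precisely the smallness hypothesis of the next level
      step.\<close>
    have G_le: "G k \<le> V k" for k
    proof (induction k)
      case 0
      then show ?case using start by (simp add: G_def t_def)
    next
      case (Suc k)
      have "(1/2 :: real) powr p \<le> (1/2) powr p0"
        using p by (intro powr_mono') auto
      also have "(1/2 :: real) powr p0 = q ^ DIM('a) * (1/2) ^ N"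
        by (simp add: p0_def powr_add qn powr_realpow)
      finally have half: "(1/2 :: real) powr p \<le> q ^ DIM('a) * (1/2) ^ N" .
      have tk: "t (Suc k) - t k = \<epsilon> / 2 ^ Suc k"
        by (simp add: t_def field_simps)
      moreover have "0 < \<epsilon> / 2 ^ Suc k"
        using assms by simp
      ultimately have "t k < t (Suc k)"
        by linarith
      have "2 * V k \<le> measure lebesgue (U \<inter> ball x (R k))" if "x \<in> U" for x
        using dens[OF that R] by (simp add: V_def)
      then have "ennreal ((t (Suc k) - t k) powr p / (C * R k) powr (?n + s * p) * V k * G (Suc k))
          \<le> gagliardo d s p U u"
        unfolding G_def using Um u d C R V[of k] \<open>p > 0\<close> assms Suc \<open>t k < t (Suc k)\<close>
        by (intro gagliardo_level_step) (auto simp: G_def)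
      also note g
      finally have 1: "(\<epsilon> / 2 ^ Suc k) powr p / (C * R k) powr (?n + s * p) * V k * G (Suc k) \<le> \<Lambda> powr p"
        by (simp add: tk)
      have CR: "C * R k > 0"
        using C R by simp
      have "(C * R k) powr s = (C * R0) powr s * (1/4) ^ k"
        using C R0 q by (simp add: R_def powr_mult powr_power powr_powr mult.commute
            flip: powr_realpow q(3))
      also have "\<dots> \<le> \<epsilon> / (4 * \<Lambda>) * (1/4) ^ k"
        using CR0 by (intro mult_right_mono) auto
      finally have CRs: "(C * R k) powr s \<le> \<epsilon> / (4 * \<Lambda>) * (1/4) ^ k" .
      have "\<epsilon> / 2 ^ Suc k = (2 ^ Suc k * \<Lambda>) * (\<epsilon> / (4 * \<Lambda>) * (1/4) ^ k)"
        using assms by (simp add: field_simps flip: power_mult_distrib)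
      also have "\<dots> \<ge> (2 ^ Suc k * \<Lambda>) * (C * R k) powr s"
        using CRs assms by (intro mult_left_mono) auto
      finally have "((2 ^ Suc k * \<Lambda>) * (C * R k) powr s) powr p \<le> (\<epsilon> / 2 ^ Suc k) powr p"
        using assms \<open>p > 0\<close> by (intro powr_mono2) auto
      moreover have "((2 ^ Suc k * \<Lambda>) * (C * R k) powr s) powr p =
          (2 ^ Suc k) powr p * \<Lambda> powr p * (C * R k) powr (s * p)"
        using assms CR by (simp add: powr_mult powr_powr)
      ultimately have "(2 ^ Suc k) powr p * \<Lambda> powr p * (C * R k) powr (s * p) \<le> (\<epsilon> / 2 ^ Suc k) powr p"
        by simp
      then have "(2 ^ Suc k) powr p * \<Lambda> powr p * (C * R k) powr (s * p) /
            ((C * R k) powr ?n * (C * R k) powr (s * p))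
          \<le> (\<epsilon> / 2 ^ Suc k) powr p / ((C * R k) powr ?n * (C * R k) powr (s * p))"
        by (intro divide_right_mono) auto
      then have "(2 ^ Suc k) powr p * \<Lambda> powr p / (C * R k) powr ?n \<le>
          (\<epsilon> / 2 ^ Suc k) powr p / (C * R k) powr (?n + s * p)"
        using CR C(1) R(1)[of k] by (simp only: powr_add) simp
      \<comment> \<open>The gap bound replaces the energy density by
        \<open>(2 ^ Suc k * \<Lambda>) powr p / (C * R k) powr n\<close>; cancelling
        \<open>\<Lambda> powr p\<close> then leaves an estimate of \<open>G (Suc k)\<close> free of
        the radius.\<close>
      then have "(2 ^ Suc k) powr p * \<Lambda> powr p / (C * R k) powr ?n * (V k * G (Suc k)) \<le> \<Lambda> powr p"
        using 1 V[of k] by (intro order_trans[OF mult_right_mono 1[unfolded mult.assoc]])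
          (auto simp: G_def)
      moreover have "V k = (C * R k) powr ?n / A"
        using C R[of k] r0 by (simp add: V_def A_def powr_mult powr_realpow)
      moreover have "b / X * (X / A * G (Suc k)) = b * G (Suc k) / A" if "X > 0" for b X
        using that by simp
      moreover have "(C * R k) powr ?n > 0"
        using CR C(1) R(1)[of k] by simp
      ultimately have "(2 ^ Suc k) powr p * \<Lambda> powr p * G (Suc k) / A \<le> \<Lambda> powr p"
        by metis
      then have "(2 ^ Suc k) powr p * G (Suc k) / A * \<Lambda> powr p \<le> 1 * \<Lambda> powr p"
        by (simp add: mult_ac)
      then have "(2 ^ Suc k) powr p * G (Suc k) / A \<le> 1"
        using assms by (subst (asm) mult_le_cancel_right_pos) auto
      then have "G (Suc k) \<le> A / (2 ^ Suc k) powr p"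
        using A by (simp add: field_simps)
      also have "\<dots> = A * ((1/2) powr p) ^ Suc k"
      proof -
        have "(2 ^ m :: real) powr p = (2 powr p) ^ m" for m
          by (induction m) (simp_all add: powr_mult)
        then show ?thesis
          by (simp only: powr_divide power_divide) simp
      qed
      also have "\<dots> \<le> A * (q ^ DIM('a) * (1/2) ^ N) ^ Suc k"
        using A half by (intro mult_left_mono power_mono) auto
      also have "A * (q ^ DIM('a) * (1/2) ^ N) ^ Suc k = A * ((1/2) ^ N) ^ Suc k * (q ^ DIM('a)) ^ Suc k"
        by (simp add: power_mult_distrib mult_ac)
      also have "\<dots> \<le> A * (1/2) ^ N * (q ^ DIM('a)) ^ Suc k"
        using A q by (intro mult_right_mono mult_left_mono power_Suc_le_self) (auto simp: power_le_one)
      also have "\<dots> \<le> V 0 * (q ^ DIM('a)) ^ Suc k"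
        using N A q by (intro mult_right_mono) (auto simp: field_simps)
      finally show ?case
        using V_eq[of "Suc k"] by simp
    qed
    \<comment> \<open>All levels \<open>t k\<close> lie below \<open>a\<close>, and
      \<open>V k\<close> tends to 0.\<close>
    have "measure ?M {x \<in> U. a \<le> u x} \<le> V k" for k
    proof -
      have "t k < a" using \<open>\<epsilon> > 0\<close> by (simp add: t_def)
      then have "measure ?M {x \<in> U. a \<le> u x} \<le> G k"
        unfolding G_def by (intro finite_measure_mono) (auto intro: sets_lebesgue_on_level[OF u])
      with G_le[of k] show ?thesis by simp
    qed
    then have "measure ?M {x \<in> U. a \<le> u x} \<le> V 0 * (q ^ DIM('a)) ^ k" for k
      by (metis V_eq)
    moreover have "(\<lambda>k. V 0 * (q ^ DIM('a)) ^ k) \<longlonglongrightarrow> V 0 * 0"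
      using q by (intro tendsto_intros LIMSEQ_power_zero) (auto simp: power_less_one_iff)
    ultimately have "measure ?M {x \<in> U. a \<le> u x} \<le> V 0 * 0"
      by (intro LIMSEQ_le_const) auto
    then show ?thesis
      using measure_nonneg[of ?M "{x \<in> U. a \<le> u x}"] by linarith
  qed
  show ?thesis
    using V[of 0] p0 null by blast
qed

section \<open>The limit of the eigenvalues\<close>

lemma eventually_powr_less:
  fixes \<theta> \<delta> :: real
  assumes "0 < \<theta>" "\<theta> < 1" "0 < \<delta>"
  shows "\<forall>\<^sub>F p in at_top. \<theta> powr p < \<delta>"
proof -
  have "filterlim (\<lambda>p. ln \<theta> * p) at_bot at_top"
    using assms by (intro filterlim_tendsto_neg_mult_at_bot[OF tendsto_const] filterlim_ident) auto
  then have "((\<lambda>p. exp (ln \<theta> * p)) \<longlongrightarrow> 0) at_top"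
    by (rule filterlim_compose[OF exp_at_bot])
  then have "((\<lambda>p. \<theta> powr p) \<longlongrightarrow> 0) at_top"
    using assms by (simp add: powr_def mult.commute)
  then show ?thesis
    using assms by (auto dest: order_tendstoD(2))
qed

section \<open>Lower bound for the eigenvalue: signed powers and the balance condition\<close>

lemma signed_powr_pos: "t \<ge> 0 \<Longrightarrow> \<bar>t\<bar> powr (p - 2) * t = t powr (p - 1)" for t p :: real
  by (cases "t = 0") (auto simp: powr_diff powr_add power2_eq_square)

lemma signed_powr_mono:
  fixes t t' p :: real
  assumes "t \<le> t'" "p \<ge> 1"
  shows "\<bar>t\<bar> powr (p - 2) * t \<le> \<bar>t'\<bar> powr (p - 2) * t'"
proof -
  have neg: "\<bar>x\<bar> powr (p - 2) * x = - ((- x) powr (p - 1))" if "x \<le> 0" for x :: real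
    using signed_powr_pos[of "- x" p] that by simp
  consider "0 \<le> t" | "t' \<le> 0" | "t \<le> 0" "0 \<le> t'" by linarith
  then show ?thesis
  proof cases
    case 1
    then have "t powr (p - 1) \<le> t' powr (p - 1)"
      using assms by (intro powr_mono2) auto
    then show ?thesis
      using 1 assms signed_powr_pos[of t p] signed_powr_pos[of t' p] by simp
  next
    case 2
    then have "(- t') powr (p - 1) \<le> (- t) powr (p - 1)"
      using assms by (intro powr_mono2) auto
    then show ?thesis
      using 2 assms neg[of t] neg[of t'] by simp
  next
    case 3
    then have "\<bar>t\<bar> powr (p - 2) * t \<le> 0" "0 \<le> \<bar>t'\<bar> powr (p - 2) * t'"
      by (auto intro: mult_nonneg_nonpos)
    then show ?thesis by linarith
  qed
qed

lemma gagliardo_uminus: "gagliardo d s p U (\<lambda>x. - u x) = gagliardo d s p U u"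
  unfolding gagliardo_def by (simp add: abs_minus_commute)

lemma frac_sobolev_measurable: "u \<in> frac_sobolev s p U \<Longrightarrow> u \<in> borel_measurable (lebesgue_on U)"
  by (simp add: frac_sobolev_def)

lemma frac_sobolev_integrable_powr:
  assumes "u \<in> frac_sobolev s p U"
  shows "integrable (lebesgue_on U) (\<lambda>x. \<bar>u x\<bar> powr p)"
  using assms by (auto simp: frac_sobolev_def integrable_iff_bounded)

text \<open>A non-integrable function has Bochner integral 0 by default, so integrability is what
  gives the balance condition content. The dominating function is \<open>1 + |u| powr p\<close>,
  integrable because \<open>U\<close> has finite measure.\<close>

lemma frac_sobolev_integrable_signed_powr:
  fixes U :: "'a::euclidean_space set"
  assumes U: "U \<in> lmeasurable" and u: "u \<in> frac_sobolev s p U" and "p \<ge> 1"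
  shows "integrable (lebesgue_on U) (\<lambda>x. \<bar>u x\<bar> powr (p - 2) * u x)"
proof (rule Bochner_Integration.integrable_bound)
  interpret finite_measure "lebesgue_on U"
    using U by (rule finite_measure_lebesgue_on)
  show "integrable (lebesgue_on U) (\<lambda>x. 1 + \<bar>u x\<bar> powr p)"
    using frac_sobolev_integrable_powr[OF u] by simp
  have [measurable]: "u \<in> borel_measurable (lebesgue_on U)"
    using u by (rule frac_sobolev_measurable)
  show "(\<lambda>x. \<bar>u x\<bar> powr (p - 2) * u x) \<in> borel_measurable (lebesgue_on U)"
    by measurable
  have "\<bar>t\<bar> powr (p - 2) * \<bar>t\<bar> \<le> 1 + \<bar>t\<bar> powr p" for t :: real
  proof (cases "\<bar>t\<bar> \<le> 1")
    case True
    have "\<bar>t\<bar> powr (p - 1) \<le> 1 powr (p - 1)"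
      using True \<open>p \<ge> 1\<close> by (intro powr_mono2) auto
    then show ?thesis
      using signed_powr_pos[of "\<bar>t\<bar>" p] by (simp add: add_increasing2)
  next
    case False
    then have "\<bar>t\<bar> powr (p - 1) \<le> \<bar>t\<bar> powr p"
      by (intro powr_mono) auto
    then show ?thesis
      using signed_powr_pos[of "\<bar>t\<bar>" p] by simp
  qed
  then show "AE x in lebesgue_on U. norm (\<bar>u x\<bar> powr (p - 2) * u x) \<le> norm (1 + \<bar>u x\<bar> powr p)"
    by (auto simp: abs_mult)
qed

text \<open>Level sets cannot be thin near their top, so \<open>u\<close> is close to its maximum on a set of measure
  at least \<open>\<eta>\<close>. The balance condition on \<open>|u|\<^sup>p\<^sup>-\<^sup>2 u\<close> forces the minimum to be almost the opposite
  of the maximum, hence \<open>|u x - u y|\<close> is almost \<open>2\<close> on a set of measure at least \<open>\<eta>\<^sup>2\<close>.\<close>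

lemma neumann_eigenvalue_ge:
  fixes U :: "'a::euclidean_space set"
  assumes U: "smooth_bounded_domain U" and d: "equivalent_distance d" and "s > 0"
    and D: "D > 0" "\<And>x y. x \<in> U \<Longrightarrow> y \<in> U \<Longrightarrow> d x y \<le> D"
    and a: "0 < a" "a < 2 / D powr s"
  shows "\<forall>\<^sub>F p in at_top. ennreal (a powr p) \<le> neumann_eigenvalue d s p U"
proof -
  let ?M = "lebesgue_on U" and ?n = "real DIM('a)"
  have Um: "U \<in> lmeasurable"
    using U by (rule smooth_bounded_domain_lmeasurable)
  interpret finite_measure ?M
    using Um by (rule finite_measure_lebesgue_on)
  define m where "m = measure ?M U + 1"
  have m: "m > 0" "measure ?M U \<le> m"
    by (auto simp: m_def add_nonneg_pos)
  have Ds: "D powr s > 0"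
    using D by simp
  have aD: "0 < a * D powr s" "a * D powr s < 2"
    using a Ds by (auto simp: field_simps)
  \<comment> \<open>This makes \<open>2 - 6 * \<epsilon>\<close>, the oscillation found below as
    \<open>(1 - 2 * \<epsilon>) + (1 - 4 * \<epsilon>)\<close>, the midpoint of
    \<open>a * D powr s\<close> and 2.\<close>
  define \<epsilon> where "\<epsilon> = (2 - a * D powr s) / 12"
  have \<epsilon>: "\<epsilon> > 0" "\<epsilon> < 1/6" "a * D powr s < 2 - 6 * \<epsilon>"
  proof -
    have "2 - 6 * \<epsilon> = 1 + a * D powr s / 2"
      by (simp add: \<epsilon>_def field_simps)
    then show "a * D powr s < 2 - 6 * \<epsilon>"
      using aD by linarith
  qed (use aD in \<open>auto simp: \<epsilon>_def\<close>)
  obtain \<eta> p0 where \<eta>: "\<eta> > 0" and p0: "p0 > 0"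
    and level_sets: "\<forall>p\<ge>p0. \<forall>u\<in>borel_measurable ?M. \<forall>b.
      gagliardo d s p U u \<le> ennreal (a powr p) \<longrightarrow>
      measure ?M {x \<in> U. b - \<epsilon> < u x} \<le> \<eta> \<longrightarrow> measure ?M {x \<in> U. b \<le> u x} = 0"
    using gagliardo_level_sets[OF U d \<open>s > 0\<close> \<epsilon>(1) a(1)] by blast
  note levels = level_sets[rule_format]
  define \<theta> where "\<theta> = (1 - 3 * \<epsilon>) / (1 - 2 * \<epsilon>)"
  have \<theta>: "0 < \<theta>" "\<theta> < 1"
    using \<epsilon> by (auto simp: \<theta>_def field_simps)
  define \<tau> where "\<tau> = a * D powr s / (2 - 6 * \<epsilon>)"
  have \<tau>: "0 < \<tau>" "\<tau> < 1"
    using \<epsilon> aD by (auto simp: \<tau>_def field_simps)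
  \<comment> \<open>The three power conditions serve, in this order, the normalisation, the balance
    condition and the final energy bound.\<close>
  have "\<forall>\<^sub>F p in at_top. p \<ge> max p0 2 \<and> (1 - \<epsilon>) powr p < 1 / m \<and> \<theta> powr p < \<eta> * \<theta> / m
      \<and> \<tau> powr p < \<eta> * \<eta> / D powr ?n"
    using \<epsilon> \<theta> \<tau> m \<eta> D by (intro eventually_conj eventually_ge_at_top eventually_powr_less) auto
  then show ?thesis
  proof eventually_elim
    case (elim p)
    then have p: "p0 \<le> p" "p \<ge> 2" and p1: "(1 - \<epsilon>) powr p * m < 1"
      and p2: "\<theta> powr p < \<eta> * \<theta> / m" and p3: "\<tau> powr p < \<eta> * \<eta> / D powr ?n"
      using m by (auto simp: field_simps)
    have p2': "(1 - 3 * \<epsilon>) powr (p - 1) * m < (1 - 2 * \<epsilon>) powr (p - 1) * \<eta>"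
    proof -
      have "\<theta> powr (p - 1) * m < \<eta>"
        using p2 \<theta> m by (simp add: powr_diff field_simps)
      moreover have "\<theta> powr (p - 1) = (1 - 3 * \<epsilon>) powr (p - 1) / (1 - 2 * \<epsilon>) powr (p - 1)"
        using \<epsilon> by (simp add: \<theta>_def powr_divide)
      ultimately show ?thesis
        using \<epsilon> by (simp add: field_simps)
    qed
    have p3': "a powr p \<le> (2 - 6 * \<epsilon>) powr p / D powr (?n + s * p) * \<eta> * \<eta>"
    proof -
      have "\<tau> powr p = a powr p * D powr (s * p) / (2 - 6 * \<epsilon>) powr p"
        using \<epsilon> a D by (simp add: \<tau>_def powr_divide powr_mult powr_powr)
      with p3 have "a powr p * D powr (s * p) / (2 - 6 * \<epsilon>) powr p < \<eta> * \<eta> / D powr ?n"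
        by simp
      then show ?thesis
        using \<epsilon> D by (simp add: powr_add field_simps)
    qed
    \<comment> \<open>The norm only shows that \<open>|u|\<close> comes close to 1, so the argument
      is stated for a \<open>w\<close> that is later \<open>u\<close> or \<open>- u\<close>.\<close>
    have key: "ennreal (a powr p) \<le> gagliardo d s p U w"
      if w [measurable]: "w \<in> borel_measurable ?M"
        and int: "integrable ?M (\<lambda>x. \<bar>w x\<bar> powr (p - 2) * w x)"
        and bal: "(\<integral>x. \<bar>w x\<bar> powr (p - 2) * w x \<partial>?M) = 0"
        and top: "measure ?M {x \<in> U. 1 - \<epsilon> \<le> w x} \<noteq> 0" for w
    \<comment> \<open>Denying the claim provides exactly the energy bound under which
      \<open>level_sets\<close> applies.\<close>
    proof (rule ccontr)
      assume "\<not> ?thesis"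
      then have g: "gagliardo d s p U w \<le> ennreal (a powr p)"
        and g': "gagliardo d s p U w < ennreal (a powr p)" by auto
      \<comment> \<open>Each passage costs one \<open>\<epsilon>\<close>: \<open>level_sets\<close>
        from \<open>1 - \<epsilon>\<close> to \<open>1 - 2 * \<epsilon>\<close>, the balance
        condition to \<open>1 - 3 * \<epsilon>\<close> for \<open>- w\<close>, and
        \<open>level_sets\<close> again to \<open>1 - 4 * \<epsilon>\<close>.\<close>
      define E where "E = {x \<in> U. 1 - 2 * \<epsilon> < w x}"
      define F where "F = {x \<in> U. 1 - 4 * \<epsilon> < - w x}"
      have E [measurable]: "E \<in> sets ?M"
        unfolding E_def by measurable
      have F [measurable]: "F \<in> sets ?M"
        unfolding F_def by (rule sets_lebesgue_on_level) simp
      have E_large: "measure ?M E > \<eta>"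
        using levels[OF p(1) w g, of "1 - \<epsilon>"] top by (force simp: E_def)
      have "measure ?M {x \<in> U. 1 - 3 * \<epsilon> \<le> - w x} \<noteq> 0"
      proof
        assume "measure ?M {x \<in> U. 1 - 3 * \<epsilon> \<le> - w x} = 0"
        moreover have "{x \<in> U. 1 - 3 * \<epsilon> \<le> - w x} \<in> sets ?M"
          by (rule sets_lebesgue_on_level) simp
        ultimately have "{x \<in> U. 1 - 3 * \<epsilon> \<le> - w x} \<in> null_sets ?M"
          by (auto simp: emeasure_eq_measure)
        then have ae: "AE x in ?M. \<not> 1 - 3 * \<epsilon> \<le> - w x"
          by (rule AE_I') auto
        \<comment> \<open>A minorant of the signed power: large on \<open>E\<close>, and nowhere too
          negative as \<open>- w\<close> stays below \<open>1 - 3 * \<epsilon>\<close>. By the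
          choice of \<open>p\<close> its integral would be positive once \<open>E\<close> has
          measure above \<open>\<eta>\<close>, against the balance.\<close>
        have "(\<integral>x. (1 - 2 * \<epsilon>) powr (p - 1) * indicator E x - (1 - 3 * \<epsilon>) powr (p - 1) \<partial>?M)
            \<le> (\<integral>x. \<bar>w x\<bar> powr (p - 2) * w x \<partial>?M)"
        proof (rule integral_mono_AE)
          show "integrable ?M (\<lambda>x. (1 - 2 * \<epsilon>) powr (p - 1) * indicator E x - (1 - 3 * \<epsilon>) powr (p - 1))"
            by (intro Bochner_Integration.integrable_diff integrable_mult_right integrable_real_indicator
                integrable_const E) (simp add: emeasure_eq_measure)
          show "AE x in ?M. (1 - 2 * \<epsilon>) powr (p - 1) * indicator E x - (1 - 3 * \<epsilon>) powr (p - 1)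
              \<le> \<bar>w x\<bar> powr (p - 2) * w x"
            using ae AE_space
          proof eventually_elim
            case (elim x)
            show ?case
            proof (cases "x \<in> E")
              case True
              have "(1 - 2 * \<epsilon>) powr (p - 1) = \<bar>1 - 2 * \<epsilon>\<bar> powr (p - 2) * (1 - 2 * \<epsilon>)"
                using \<epsilon> by (subst signed_powr_pos) auto
              also have "\<dots> \<le> \<bar>w x\<bar> powr (p - 2) * w x"
                using True p by (intro signed_powr_mono) (auto simp: E_def)
              finally show ?thesis
                using True powr_ge_zero[of "1 - 3 * \<epsilon>" "p - 1"] by (simp del: powr_ge_zero)
            next
              case False
              have "- ((1 - 3 * \<epsilon>) powr (p - 1)) = \<bar>- (1 - 3 * \<epsilon>)\<bar> powr (p - 2) * (- (1 - 3 * \<epsilon>))"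
                using \<epsilon> signed_powr_pos[of "1 - 3 * \<epsilon>" p] by (simp only: abs_minus_cancel mult_minus_right)
              also have "\<dots> \<le> \<bar>w x\<bar> powr (p - 2) * w x"
                using elim p by (intro signed_powr_mono) auto
              finally show ?thesis
                using False by simp
            qed
          qed
        qed (rule int)
        also note bal
        also have "(\<integral>x. (1 - 2 * \<epsilon>) powr (p - 1) * indicator E x - (1 - 3 * \<epsilon>) powr (p - 1) \<partial>?M)
            = (1 - 2 * \<epsilon>) powr (p - 1) * measure ?M E - (1 - 3 * \<epsilon>) powr (p - 1) * measure ?M U"
          using sets.sets_into_space[OF E]
          by (subst Bochner_Integration.integral_diff)
            (auto simp: Int_absorb2 mult.commute emeasure_eq_measure intro!: integrable_real_indicator)
        finally have "(1 - 2 * \<epsilon>) powr (p - 1) * measure ?M E \<le> (1 - 3 * \<epsilon>) powr (p - 1) * measure ?M U"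
          by simp
        also have "\<dots> \<le> (1 - 3 * \<epsilon>) powr (p - 1) * m"
          using m by (intro mult_left_mono) auto
        also note p2'
        finally have "measure ?M E < \<eta>"
          using \<epsilon> by simp
        then show False using E_large by simp
      qed
      then have F_large: "measure ?M F > \<eta>"
        using levels[OF p(1), of "\<lambda>x. - w x" "1 - 3 * \<epsilon>"] g by (force simp: F_def gagliardo_uminus)
      have "ennreal ((2 - 6 * \<epsilon>) powr p / D powr (?n + s * p) * \<eta> * measure ?M E) \<le> gagliardo d s p U w"
      proof (rule gagliardo_ge[where B = "\<lambda>_. F"])
        fix x y assume x: "x \<in> E" and y: "y \<in> F"
        then have "x \<noteq> y"
          using \<epsilon> by (auto simp: E_def F_def)
        then have "d x y > 0"
          using equivalent_distanceD(1,3)[OF d, of x y] by auto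
        moreover have "d x y \<le> D"
          using x y D by (auto simp: E_def F_def)
        moreover have "2 - 6 * \<epsilon> \<le> \<bar>w x - w y\<bar>"
          using x y by (auto simp: E_def F_def)
        ultimately show "(2 - 6 * \<epsilon>) powr p / D powr (?n + s * p)
            \<le> \<bar>w x - w y\<bar> powr p / d x y powr (?n + s * p)"
          using \<epsilon> p \<open>s > 0\<close> by (intro frac_le powr_mono2) auto
      qed (use E F F_large \<eta> finite_measure_axioms in auto)
      moreover have "a powr p \<le> (2 - 6 * \<epsilon>) powr p / D powr (?n + s * p) * \<eta> * measure ?M E"
        using E_large \<eta> by (intro order_trans[OF p3'] mult_left_mono) auto
      ultimately have "ennreal (a powr p) \<le> gagliardo d s p U w"
        by (meson ennreal_leI order_trans)
      then show False
        using g' by simp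
    qed
    show "ennreal (a powr p) \<le> neumann_eigenvalue d s p U"
      unfolding neumann_eigenvalue_def
    proof (rule INF_greatest)
      fix u assume "u \<in> neumann_admissible s p U"
      then have uS: "u \<in> frac_sobolev s p U" and norm: "Lp_norm p U u = 1"
        and bal: "(\<integral>x. \<bar>u x\<bar> powr (p - 2) * u x \<partial>?M) = 0"
        by (auto simp: neumann_admissible_def)
      have u [measurable]: "u \<in> borel_measurable ?M"
        using uS by (rule frac_sobolev_measurable)
      have int: "integrable ?M (\<lambda>x. \<bar>u x\<bar> powr (p - 2) * u x)"
        using p by (intro frac_sobolev_integrable_signed_powr[OF Um uS]) auto
      have one: "(\<integral>x. \<bar>u x\<bar> powr p \<partial>?M) = 1"
      proof -
        have "(\<integral>x. \<bar>u x\<bar> powr p \<partial>?M) = ((\<integral>x. \<bar>u x\<bar> powr p \<partial>?M) powr (1 / p)) powr p"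
          using p by (simp add: powr_powr)
        then show ?thesis
          using norm by (simp add: Lp_norm_def)
      qed
      \<comment> \<open>Otherwise \<open>|u| < 1 - \<epsilon>\<close> almost everywhere, and the
        integral of \<open>|u| powr p\<close> would be at most
        \<open>(1 - \<epsilon>) powr p * m < 1\<close>.\<close>
      have "measure ?M {x \<in> U. 1 - \<epsilon> \<le> u x} \<noteq> 0 \<or> measure ?M {x \<in> U. 1 - \<epsilon> \<le> - u x} \<noteq> 0"
      proof (rule ccontr)
        assume "\<not> ?thesis"
        moreover have "{x \<in> U. 1 - \<epsilon> \<le> u x} \<in> sets ?M" "{x \<in> U. 1 - \<epsilon> \<le> - u x} \<in> sets ?M"
          by (auto intro!: sets_lebesgue_on_level)
        ultimately have null: "{x \<in> U. 1 - \<epsilon> \<le> u x} \<in> null_sets ?M" "{x \<in> U. 1 - \<epsilon> \<le> - u x} \<in> null_sets ?M"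
          by (auto simp: emeasure_eq_measure)
        have "AE x in ?M. \<not> 1 - \<epsilon> \<le> u x"
          by (rule AE_I'[OF null(1)]) auto
        moreover have "AE x in ?M. \<not> 1 - \<epsilon> \<le> - u x"
          by (rule AE_I'[OF null(2)]) auto
        ultimately have "AE x in ?M. \<bar>u x\<bar> powr p \<le> (1 - \<epsilon>) powr p"
        proof eventually_elim
          case (elim x)
          then show ?case using p by (intro powr_mono2) auto
        qed
        then have "(\<integral>x. \<bar>u x\<bar> powr p \<partial>?M) \<le> (\<integral>x. (1 - \<epsilon>) powr p \<partial>?M)"
          by (intro integral_mono_AE frac_sobolev_integrable_powr[OF uS]) auto
        also have "\<dots> = (1 - \<epsilon>) powr p * measure ?M U"
          by (simp add: mult.commute)
        also have "\<dots> \<le> (1 - \<epsilon>) powr p * m"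
          using m by (intro mult_left_mono) auto
        finally show False
          using p1 one by simp
      qed
      then show "ennreal (a powr p) \<le> gagliardo d s p U u"
      proof
        assume "measure ?M {x \<in> U. 1 - \<epsilon> \<le> u x} \<noteq> 0"
        then show ?thesis using u int bal by (intro key)
      next
        assume "measure ?M {x \<in> U. 1 - \<epsilon> \<le> - u x} \<noteq> 0"
        then have "ennreal (a powr p) \<le> gagliardo d s p U (\<lambda>x. - u x)"
          using u int bal by (intro key) auto
        then show ?thesis by (simp add: gagliardo_uminus)
      qed
    qed
  qed
qed

section \<open>Upper bound for the eigenvalue: Lipschitz test functions\<close>

text \<open>The Lipschitz bound turns the integrand into a power of the distance with exponent
  \<open>p * (1 - s) - n\<close>, \<open>n\<close> the dimension. This is nonnegative for large
  \<open>p\<close>, so the singularity disappears. It serves for \<open>dist\<close> (membership in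
  the Sobolev space) and for \<open>d\<close> (the energy).\<close>

lemma gagliardo_le:
  fixes U :: "'a::euclidean_space set"
  assumes U: "U \<in> lmeasurable" and \<rho>: "equivalent_distance \<rho>"
    and lip: "\<And>x y. x \<in> U \<Longrightarrow> y \<in> U \<Longrightarrow> \<bar>u x - u y\<bar> \<le> L * \<rho> x y"
    and R: "\<And>x y. x \<in> U \<Longrightarrow> y \<in> U \<Longrightarrow> \<rho> x y \<le> R"
    and "0 \<le> L" "0 < p" "real DIM('a) \<le> p * (1 - s)"
  shows "gagliardo \<rho> s p U u \<le> ennreal (L powr p * R powr (p * (1 - s) - real DIM('a)) *
    (measure (lebesgue_on U) U)\<^sup>2)"
proof -
  interpret finite_measure "lebesgue_on U"
    using U by (rule finite_measure_lebesgue_on)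
  let ?K = "L powr p * R powr (p * (1 - s) - real DIM('a))"
  have le: "\<bar>u x - u y\<bar> powr p / \<rho> x y powr (real DIM('a) + s * p) \<le> ?K" if "x \<in> U" "y \<in> U" for x y
  proof (cases "x = y")
    case False
    then have pos: "\<rho> x y > 0"
      using equivalent_distanceD(1,3)[OF \<rho>, of x y] by auto
    have "\<bar>u x - u y\<bar> powr p \<le> L powr p * \<rho> x y powr p"
      using lip[OF that] pos assms by (auto simp flip: powr_mult intro!: powr_mono2)
    then have "\<bar>u x - u y\<bar> powr p / \<rho> x y powr (real DIM('a) + s * p)
        \<le> L powr p * \<rho> x y powr p / \<rho> x y powr (real DIM('a) + s * p)"
      by (intro divide_right_mono) auto
    also have "\<dots> = L powr p * \<rho> x y powr (p * (1 - s) - real DIM('a))"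
    proof -
      have "p * (1 - s) - real DIM('a) = p - (real DIM('a) + s * p)"
        by (simp add: algebra_simps)
      then show ?thesis
        by (simp only: powr_diff times_divide_eq_right)
    qed
    also have "\<dots> \<le> ?K"
      using pos R[OF that] assms by (intro mult_left_mono powr_mono2) auto
    finally show ?thesis .
  qed simp
  have "gagliardo \<rho> s p U u \<le> (\<integral>\<^sup>+x. (\<integral>\<^sup>+y. ennreal ?K \<partial>lebesgue_on U) \<partial>lebesgue_on U)"
    unfolding gagliardo_def using le by (intro nn_integral_mono ennreal_leI) auto
  also have "\<dots> = ennreal (?K * (measure (lebesgue_on U) U)\<^sup>2)"
    by (simp add: emeasure_eq_measure power2_eq_square mult.assoc flip: ennreal_mult)
  finally show ?thesis .
qed

lemma measure_open_Int_pos: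
  fixes U :: "'a::euclidean_space set"
  assumes "open U" "bounded U" "open V" "x \<in> V" "x \<in> closure U"
  shows "measure (lebesgue_on U) (U \<inter> V) > 0"
proof -
  have "V \<inter> U \<noteq> {}"
    using assms open_Int_closure_eq_empty by blast
  then obtain y where "y \<in> U \<inter> V"
    by auto
  moreover have "open (U \<inter> V)"
    using assms by auto
  ultimately obtain e where "e > 0" "ball y e \<subseteq> U \<inter> V"
    by (meson open_contains_ball)
  have "U \<inter> V \<in> lmeasurable"
    using assms by (intro lmeasurable_open bounded_Int) auto
  have "0 < measure lebesgue (ball y e)"
    using content_ball_pos[OF \<open>e > 0\<close>, of y] by simp
  also have "\<dots> \<le> measure lebesgue (U \<inter> V)"
    using \<open>ball y e \<subseteq> U \<inter> V\<close> \<open>U \<inter> V \<in> lmeasurable\<close> by (intro measure_mono_fmeasurable) auto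
  also have "\<dots> = measure (lebesgue_on U) (U \<inter> V)"
    using assms by (subst measure_restrict_space) auto
  finally show ?thesis .
qed

text \<open>Intermediate value theorem in \<open>c\<close>: the integral is nonnegative at
  \<open>c = 0\<close> and nonpositive at \<open>c = D\<close>. Continuity is dominated convergence
  with the constant bound \<open>D powr (p - 1)\<close>; \<open>p > 2\<close> makes the factor with
  exponent \<open>p - 2\<close> continuous at 0.\<close>

lemma exists_balancing_constant:
  fixes v :: "'a \<Rightarrow> real"
  assumes "finite_measure M" and v [measurable]: "v \<in> borel_measurable M"
    and b: "\<And>x. x \<in> space M \<Longrightarrow> 0 \<le> v x" "\<And>x. x \<in> space M \<Longrightarrow> v x \<le> D"
    and "0 \<le> D" "p > 2"
  obtains c where "0 \<le> c" "c \<le> D" "(\<integral>x. \<bar>v x - c\<bar> powr (p - 2) * (v x - c) \<partial>M) = 0"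
proof -
  interpret finite_measure M by fact
  let ?I = "\<lambda>c. \<integral>x. \<bar>v x - c\<bar> powr (p - 2) * (v x - c) \<partial>M"
  have "continuous_on {0..D} ?I"
    unfolding continuous_on_sequentially
  proof (intro allI ballI impI, elim conjE)
    fix X :: "nat \<Rightarrow> real" and c assume "c \<in> {0..D}" and X: "\<forall>n. X n \<in> {0..D}" "X \<longlonglongrightarrow> c"
    show "(?I \<circ> X) \<longlonglongrightarrow> ?I c"
      unfolding o_def
    proof (rule integral_dominated_convergence[where w = "\<lambda>_. D powr (p - 1)"])
      show "AE x in M. (\<lambda>n. \<bar>v x - X n\<bar> powr (p - 2) * (v x - X n)) \<longlonglongrightarrow> \<bar>v x - c\<bar> powr (p - 2) * (v x - c)"
        using X(2) \<open>p > 2\<close> by (intro AE_I2 tendsto_intros tendsto_powr') auto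
      fix n
      show "AE x in M. norm (\<bar>v x - X n\<bar> powr (p - 2) * (v x - X n)) \<le> D powr (p - 1)"
      proof (rule AE_I2)
        fix x assume "x \<in> space M"
        then have "\<bar>v x - X n\<bar> \<le> D"
          using b[of x] X(1)[rule_format, of n] by (auto simp: abs_le_iff)
        then have "\<bar>v x - X n\<bar> powr (p - 1) \<le> D powr (p - 1)"
          using \<open>p > 2\<close> by (intro powr_mono2) auto
        then show "norm (\<bar>v x - X n\<bar> powr (p - 2) * (v x - X n)) \<le> D powr (p - 1)"
          using signed_powr_pos[of "\<bar>v x - X n\<bar>" p] by (simp add: abs_mult)
      qed
    qed auto
  qed
  moreover have "?I D \<le> 0"
  proof -
    have "0 \<le> (\<integral>x. - (\<bar>v x - D\<bar> powr (p - 2) * (v x - D)) \<partial>M)"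
      using b by (intro integral_nonneg_AE AE_I2) (auto intro: mult_nonneg_nonpos)
    then show ?thesis by simp
  qed
  moreover have "0 \<le> ?I 0"
    using b by (intro integral_nonneg_AE AE_I2 mult_nonneg_nonneg) auto
  ultimately obtain c where "0 \<le> c" "c \<le> D" "?I c = 0"
    using IVT2'[of ?I D 0 0] \<open>0 \<le> D\<close> by auto
  then show ?thesis
    by (rule that)
qed

text \<open>The test function is the distance to \<open>x0\<close>, shifted and normalised. Since it is Lipschitz and
  \<open>s < 1\<close>, its seminorm is finite for large \<open>p\<close>.\<close>

lemma neumann_eigenvalue_le:
  fixes U :: "'a::euclidean_space set"
  assumes U: "smooth_bounded_domain U" and d: "equivalent_distance d" and "s < 1"
    and xy: "x0 \<in> closure U" "y0 \<in> closure U" and D: "d x0 y0 = D" "D > 0"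
    and max: "\<And>x y. x \<in> closure U \<Longrightarrow> y \<in> closure U \<Longrightarrow> d x y \<le> D"
    and a: "2 / D powr s < a"
  shows "\<forall>\<^sub>F p in at_top. neumann_eigenvalue d s p U \<le> ennreal (a powr p)"
proof -
  let ?M = "lebesgue_on U" and ?n = "real DIM('a)"
  have Uo: "open U" "bounded U"
    using U by (auto simp: smooth_bounded_domain_def)
  have Um: "U \<in> lmeasurable"
    using U by (rule smooth_bounded_domain_lmeasurable)
  interpret finite_measure ?M
    using Um by (rule finite_measure_lebesgue_on)
  have in_closure: "x \<in> closure U" if "x \<in> U" for x
    using that closure_subset by blast
  have "a > 0"
    using a D by (smt (verit) divide_pos_pos powr_gt_zero)
  have "D powr (1 - s) / a < D / 2"
    using a \<open>a > 0\<close> D by (simp add: powr_diff field_simps)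
  \<comment> \<open>The hypothesis \<open>2 / D powr s < a\<close> says exactly that this interval
    is nonempty. The number \<open>\<kappa>\<close> bounds the size of the shifted distance function
    from below on a set of positive measure.\<close>
  then obtain \<kappa> where \<kappa>: "D powr (1 - s) / a < \<kappa>" "\<kappa> < D / 2"
    using dense by blast
  have "\<kappa> > 0"
    using \<kappa>(1) \<open>a > 0\<close> D by (smt (verit) divide_pos_pos powr_gt_zero)
  define v where "v x = d x x0" for x
  have v_cont: "continuous_on S v" for S
    unfolding v_def[abs_def] by (rule continuous_on_equivalent_distance_left[OF d])
  have v [measurable]: "v \<in> borel_measurable ?M"
    using Um v_cont by (intro continuous_imp_measurable_on_sets_lebesgue) auto
  have v_bounds: "0 \<le> v x" "x \<in> U \<Longrightarrow> v x \<le> D" for x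
    using equivalent_distanceD(1)[OF d] max xy in_closure by (auto simp: v_def)
  have v_lip: "\<bar>v x - v y\<bar> \<le> d x y" for x y
    using equivalent_distanceD(4)[OF d, of x x0 y] equivalent_distanceD(4)[OF d, of y x0 x]
      equivalent_distanceD(2)[OF d, of x y] by (auto simp: v_def abs_le_iff)
  \<comment> \<open>Neighbourhoods of the two ends of the diametral pair, chosen before
    \<open>p\<close>. Whatever the shift \<open>c\<close>, the values of \<open>v\<close> on one of
    them differ from \<open>c\<close> by at least \<open>\<kappa>\<close>, so \<open>m\<close> is a
    mass bound uniform in \<open>p\<close>.\<close>
  define A1 where "A1 = U \<inter> {x. v x < D / 2 - \<kappa>}"
  define A2 where "A2 = U \<inter> {x. D / 2 + \<kappa> < v x}"
  have "measure ?M A1 > 0"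
    unfolding A1_def
    using Uo xy \<kappa> equivalent_distanceD(3)[OF d, of x0 x0]
    by (intro measure_open_Int_pos[of _ _ x0] open_Collect_less v_cont continuous_intros)
      (auto simp: v_def)
  moreover have "measure ?M A2 > 0"
    unfolding A2_def
    using Uo xy \<kappa> D equivalent_distanceD(2)[OF d, of x0 y0]
    by (intro measure_open_Int_pos[of _ _ y0] open_Collect_less v_cont continuous_intros)
      (auto simp: v_def)
  moreover define m where "m = min (measure ?M A1) (measure ?M A2)"
  ultimately have m: "m > 0" "m \<le> measure ?M A1" "m \<le> measure ?M A2"
    by auto
  have A_meas [measurable]: "A1 \<in> sets ?M" "A2 \<in> sets ?M"
  proof -
    have "A1 = {x \<in> U. v x < D / 2 - \<kappa>}" "A2 = {x \<in> U. D / 2 + \<kappa> < v x}"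
      by (auto simp: A1_def A2_def)
    then show "A1 \<in> sets ?M" "A2 \<in> sets ?M"
      using sets_lebesgue_on_level[OF v] by simp_all
  qed
  define \<mu> where "\<mu> = measure ?M U + 1"
  have \<mu>: "\<mu> > 0" "measure ?M U \<le> \<mu>"
    by (auto simp: \<mu>_def add_nonneg_pos)
  \<comment> \<open>The normalised test function has energy at most
    \<open>(\<tau> * a) powr p\<close> times a factor independent of \<open>p\<close>.\<close>
  define \<tau> where "\<tau> = D powr (1 - s) / (\<kappa> * a)"
  have \<tau>: "0 < \<tau>" "\<tau> < 1"
    using \<kappa> \<open>\<kappa> > 0\<close> \<open>a > 0\<close> D by (auto simp: \<tau>_def field_simps)
  obtain C where C: "C > 0" "\<And>x y. d x y \<le> C * dist x y"
    using equivalent_distance_bounds[OF d] by metis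
  \<comment> \<open>The bound 3 secures \<open>p > 2\<close> for the balancing constant, and
    \<open>n / (1 - s)\<close>, with \<open>n\<close> the dimension, makes the exponent in
    \<open>gagliardo_le\<close> nonnegative.\<close>
  have "\<forall>\<^sub>F p in at_top. p \<ge> max 3 (?n / (1 - s)) \<and> \<tau> powr p < m * D powr ?n / \<mu>\<^sup>2"
    using \<tau> m D \<mu> by (intro eventually_conj eventually_ge_at_top eventually_powr_less) auto
  then show ?thesis
  proof eventually_elim
    case (elim p)
    then have p: "p > 2" "?n \<le> p * (1 - s)" and p\<tau>: "\<tau> powr p < m * D powr ?n / \<mu>\<^sup>2"
      using \<open>s < 1\<close> by (auto simp: field_simps)
    obtain c where c: "0 \<le> c" "c \<le> D"
      and bal: "(\<integral>x. \<bar>v x - c\<bar> powr (p - 2) * (v x - c) \<partial>?M) = 0"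
      using exists_balancing_constant[OF finite_measure_axioms v, of D p] v_bounds D p
      by auto
    define J where "J = (\<integral>x. \<bar>v x - c\<bar> powr p \<partial>?M)"
    have int: "integrable ?M (\<lambda>x. \<bar>v x - c\<bar> powr p)"
    proof (rule integrable_const_bound[where B = "D powr p"])
      have "\<bar>v x - c\<bar> powr p \<le> D powr p" if "x \<in> U" for x
        using v_bounds[of x] that c p by (intro powr_mono2) (auto simp: abs_le_iff)
      then show "AE x in ?M. norm (\<bar>v x - c\<bar> powr p) \<le> D powr p"
        by (intro AE_I2) auto
    qed measurable
    have "\<exists>A\<in>sets ?M. m \<le> measure ?M A \<and> (\<forall>x\<in>A. \<kappa> \<le> \<bar>v x - c\<bar>)"
    proof (cases "c \<ge> D / 2")
      case True
      then show ?thesis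
        using m A_meas by (intro bexI[of _ A1]) (auto simp: A1_def)
    next
      case False
      then show ?thesis
        using m A_meas by (intro bexI[of _ A2]) (auto simp: A2_def)
    qed
    then obtain A where A: "A \<in> sets ?M" "m \<le> measure ?M A" "\<And>x. x \<in> A \<Longrightarrow> \<kappa> \<le> \<bar>v x - c\<bar>"
      by auto
    have "\<kappa> powr p * m \<le> \<kappa> powr p * measure ?M A"
      using A by (intro mult_left_mono) auto
    also have "\<dots> = (\<integral>x. \<kappa> powr p * indicator A x \<partial>?M)"
      using A sets.sets_into_space[OF A(1)] by (simp add: Int_absorb2)
    also have "\<dots> \<le> J"
      unfolding J_def
    proof (rule integral_mono[OF _ int])
      show "integrable ?M (\<lambda>x. \<kappa> powr p * indicator A x)"
        by (intro integrable_mult_right integrable_real_indicator A) (simp add: emeasure_eq_measure)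
      show "\<kappa> powr p * indicator A x \<le> \<bar>v x - c\<bar> powr p" for x
        using A(3)[of x] \<open>\<kappa> > 0\<close> p by (auto simp: indicator_def intro!: powr_mono2)
    qed
    finally have J: "\<kappa> powr p * m \<le> J" .
    then have "J > 0"
      using m \<open>\<kappa> > 0\<close> by (smt (verit) mult_pos_pos powr_gt_zero)
    define N where "N = J powr (1 / p)"
    have N: "N > 0" "N powr p = J"
      using \<open>J > 0\<close> p by (auto simp: N_def powr_powr)
    define u where "u x = (v x - c) / N" for x
    have u [measurable]: "u \<in> borel_measurable ?M"
      unfolding u_def[abs_def] by measurable
    have u_powr: "\<bar>u x\<bar> powr p = \<bar>v x - c\<bar> powr p / J" for x
      using N by (simp add: u_def abs_divide powr_divide)
    have u_lip: "\<bar>u x - u y\<bar> \<le> 1 / N * d x y" for x y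
      using v_lip[of x y] N by (simp add: u_def divide_right_mono flip: diff_divide_distrib)
    have u_lip': "\<bar>u x - u y\<bar> \<le> C / N * dist x y" for x y
    proof -
      have "1 / N * d x y \<le> 1 / N * (C * dist x y)"
        using C N by (intro mult_left_mono) auto
      then show ?thesis
        using u_lip[of x y] by simp
    qed
    have int_u: "integrable ?M (\<lambda>x. \<bar>u x\<bar> powr p)"
      unfolding u_powr using int by simp
    have "(\<integral>\<^sup>+x. ennreal (\<bar>u x\<bar> powr p) \<partial>?M) < \<infinity>"
      using int_u by (simp add: integrable_iff_bounded)
    moreover have "gagliardo dist s p U u < \<infinity>"
    proof -
      obtain R where "\<And>x y. x \<in> U \<Longrightarrow> y \<in> U \<Longrightarrow> dist x y \<le> R"
        using diameter_bounded_bound[OF Uo(2)] by blast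
      then have "gagliardo dist s p U u \<le> ennreal ((C / N) powr p * R powr (p * (1 - s) - ?n) * (measure ?M U)\<^sup>2)"
        using Um u_lip' C N p by (intro gagliardo_le equivalent_distance_dist) auto
      then show ?thesis
        by (rule le_less_trans) simp
    qed
    moreover have "Lp_norm p U u = 1"
      using \<open>J > 0\<close> by (simp add: Lp_norm_def u_powr flip: J_def)
    moreover have "(\<integral>x. \<bar>u x\<bar> powr (p - 2) * u x \<partial>?M) = 0"
    proof -
      have "\<bar>u x\<bar> powr (p - 2) * u x = \<bar>v x - c\<bar> powr (p - 2) * (v x - c) / (N powr (p - 2) * N)" for x
        using N by (simp add: u_def abs_divide powr_divide)
      then show ?thesis
        using bal by simp
    qed
    ultimately have "u \<in> neumann_admissible s p U"
      using u by (simp add: neumann_admissible_def frac_sobolev_def)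
    then have "neumann_eigenvalue d s p U \<le> gagliardo d s p U u"
      unfolding neumann_eigenvalue_def by (rule INF_lower)
    also have "\<dots> \<le> ennreal ((1 / N) powr p * D powr (p * (1 - s) - ?n) * (measure ?M U)\<^sup>2)"
      using Um d u_lip N p max in_closure by (intro gagliardo_le) auto
    also have "\<dots> \<le> ennreal (a powr p)"
    proof (rule ennreal_leI)
      have "(1 / N) powr p = 1 / J"
        using N by (simp add: powr_divide)
      also have "\<dots> \<le> 1 / (\<kappa> powr p * m)"
        using J m \<open>\<kappa> > 0\<close> by (intro divide_left_mono mult_pos_pos) (auto simp: \<open>J > 0\<close>)
      finally have "(1 / N) powr p * D powr (p * (1 - s) - ?n) * (measure ?M U)\<^sup>2
          \<le> 1 / (\<kappa> powr p * m) * D powr (p * (1 - s) - ?n) * \<mu>\<^sup>2"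
        using \<mu> m by (intro mult_mono power_mono) auto
      also have "\<dots> = (D powr (1 - s)) powr p / (\<kappa> powr p * a powr p) * (\<mu>\<^sup>2 / (m * D powr ?n)) * a powr p"
      proof -
        have "1 / (k * m) * (X / Y) * M = X / (k * A) * (M / (m * Y)) * A" if "A > 0" for k X Y M A :: real
          using that by simp
        note cancel = this[where A = "a powr p" and k = "\<kappa> powr p"]
        have "D powr (p * (1 - s) - ?n) = (D powr (1 - s)) powr p / D powr ?n"
          by (simp only: powr_diff[of D "p * (1 - s)" ?n] powr_powr mult.commute)
        then show ?thesis
          using \<open>a > 0\<close> by (simp only: cancel powr_gt_zero)
      qed
      also have "(D powr (1 - s)) powr p / (\<kappa> powr p * a powr p) = \<tau> powr p"
        using \<open>a > 0\<close> \<open>\<kappa> > 0\<close> D by (simp add: \<tau>_def powr_divide powr_mult)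
      also have "\<tau> powr p * (\<mu>\<^sup>2 / (m * D powr ?n)) * a powr p \<le> 1 * a powr p"
        using p\<tau> m \<mu> D by (intro mult_right_mono) (auto simp: field_simps)
      finally show "(1 / N) powr p * D powr (p * (1 - s) - ?n) * (measure ?M U)\<^sup>2 \<le> a powr p"
        by simp
    qed
    finally show ?case .
  qed
qed

section \<open>Convergence of the eigenvalues and the duality\<close>

lemma neumann_limit_eq:
  fixes U :: "'a::euclidean_space set"
  assumes U: "smooth_bounded_domain U" and d: "equivalent_distance d" and s: "0 < s" "s < 1"
    and xy: "x0 \<in> closure U" "y0 \<in> closure U" and D: "d x0 y0 = D" "D > 0"
    and max: "\<And>x y. x \<in> closure U \<Longrightarrow> y \<in> closure U \<Longrightarrow> d x y \<le> D"
  shows "neumann_limit d s U = 2 / D powr s"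
proof -
  let ?l = "\<lambda>p. neumann_eigenvalue d s p U"
  have "((\<lambda>p. enn2real (?l p) powr (1 / p)) \<longlongrightarrow> 2 / D powr s) at_top"
  proof (rule order_tendstoI)
    fix b assume b: "b < 2 / D powr s"
    \<comment> \<open>The lower bound is available for positive bases only, while \<open>b\<close>
      may be negative.\<close>
    then have "max 0 b < 2 / D powr s"
      using D by simp
    then obtain a where a: "max 0 b < a" "a < 2 / D powr s"
      using dense by blast
    have "\<forall>\<^sub>F p in at_top. ennreal (a powr p) \<le> ?l p"
      using a max closure_subset[of U] D by (intro neumann_eigenvalue_ge[OF U d s(1) D(2)]) auto
    \<comment> \<open>A crude upper bound for finiteness: \<open>enn2real\<close> sends infinity to
      0, which would destroy the lower bound.\<close>
    moreover have "\<forall>\<^sub>F p in at_top. ?l p \<le> ennreal ((2 / D powr s + 1) powr p)"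
      by (rule neumann_eigenvalue_le[OF U d s(2) xy D max]) auto
    ultimately show "\<forall>\<^sub>F p in at_top. b < enn2real (?l p) powr (1 / p)"
      using eventually_gt_at_top[of "0::real"]
    proof eventually_elim
      case (elim p)
      then have "a powr p \<le> enn2real (?l p)"
        using enn2real_mono[OF elim(1)] by (simp add: le_less_trans)
      then have "(a powr p) powr (1 / p) \<le> enn2real (?l p) powr (1 / p)"
        using elim by (intro powr_mono2) auto
      then show ?case
        using a elim by (simp add: powr_powr)
    qed
  next
    fix b assume "2 / D powr s < b"
    then obtain a where a: "2 / D powr s < a" "a < b"
      using dense by blast
    then have "a > 0"
      using D by (smt (verit) divide_pos_pos powr_gt_zero)
    have "\<forall>\<^sub>F p in at_top. ?l p \<le> ennreal (a powr p)"
      by (rule neumann_eigenvalue_le[OF U d s(2) xy D max a(1)])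
    then show "\<forall>\<^sub>F p in at_top. enn2real (?l p) powr (1 / p) < b"
      using eventually_gt_at_top[of "0::real"]
    proof eventually_elim
      case (elim p)
      then have "enn2real (?l p) \<le> a powr p"
        using enn2real_mono[OF elim(1)] by simp
      then have "enn2real (?l p) powr (1 / p) \<le> (a powr p) powr (1 / p)"
        using elim by (intro powr_mono2) auto
      then show ?case
        using a \<open>a > 0\<close> elim by (simp add: powr_powr)
    qed
  qed
  then show ?thesis
    unfolding neumann_limit_def by (intro tendsto_Lim) auto
qed

theorem theorem1p2:
  fixes U :: "'a::euclidean_space set" and d :: "'a \<Rightarrow> 'a \<Rightarrow> real" and s :: real
  assumes "smooth_bounded_domain U"
    and "0 < s" and "s < 1"
    and "equivalent_distance d"
  defines "W \<equiv> {transport_cost d s (closure U) (pos_part (closure U) \<sigma>) (neg_part (closure U) \<sigma>) |\<sigma>.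
      \<sigma> \<in> signed_borel_measures (closure U) \<and>
      emeasure (pos_part (closure U) \<sigma>) (closure U) = 1 \<and>
      emeasure (neg_part (closure U) \<sigma>) (closure U) = 1}"
  shows "ennreal (2 / neumann_limit d s U) \<in> W \<and> (\<forall>w\<in>W. w \<le> ennreal (2 / neumann_limit d s U))"
proof -
  let ?K = "closure U"
  have U: "open U" "bounded U" "U \<noteq> {}"
    using assms(1) by (auto simp: smooth_bounded_domain_def)
  have d: "equivalent_distance d" by fact
  have "compact (?K \<times> ?K)" "?K \<times> ?K \<noteq> {}"
    using U by (auto intro!: compact_Times simp: compact_closure)
  then obtain z where z: "z \<in> ?K \<times> ?K"
    and "\<And>w. w \<in> ?K \<times> ?K \<Longrightarrow> d (fst w) (snd w) \<le> d (fst z) (snd z)"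
    using continuous_attains_sup[OF _ _ continuous_on_equivalent_distance[OF d]] by metis
  then obtain x0 y0 where xy: "x0 \<in> ?K" "y0 \<in> ?K"
    and max: "\<And>x y. x \<in> ?K \<Longrightarrow> y \<in> ?K \<Longrightarrow> d x y \<le> d x0 y0"
    by (metis fst_conv mem_Sigma_iff mem_Times_iff snd_conv)
  \<comment> \<open>If the largest distance were 0, the nonempty open set \<open>U\<close> would be
    a singleton, which is impossible in a Euclidean space.\<close>
  have "x0 \<noteq> y0"
  proof
    assume "x0 = y0"
    then have "d x y \<le> 0" if "x \<in> U" "y \<in> U" for x y
      using max[of x y] that closure_subset[of U] equivalent_distanceD(3)[OF d, of x0 x0] by auto
    then have eq: "x = y" if "x \<in> U" "y \<in> U" for x y
      using that equivalent_distanceD(1,3)[OF d, of x y] by (metis antisym)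
    obtain x where "x \<in> U" using U by auto
    then have "U = {x}" using eq by auto
    then show False
      using U not_open_singleton by metis
  qed
  then have pos: "d x0 y0 > 0"
    using equivalent_distanceD(1,3)[OF d, of x0 y0] by auto
  have "neumann_limit d s U = 2 / d x0 y0 powr s"
    using max by (intro neumann_limit_eq[OF assms(1) d assms(2,3) xy refl pos])
  then have eq: "2 / neumann_limit d s U = d x0 y0 powr s"
    using pos by simp
  have "d x y powr s \<le> d x0 y0 powr s" if "x \<in> ?K" "y \<in> ?K" for x y
    using max[OF that] equivalent_distanceD(1)[OF d, of x y] assms(2) by (intro powr_mono2) auto
  note cost = transport_cost_maximum[where d = d and s = s, OF xy \<open>x0 \<noteq> y0\<close> this]
  show ?thesis
    unfolding eq W_def by (rule conjI[OF cost])
qed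

end
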